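(* Let $k$ be a field, $\lambda\in k$, $H$ a Hopf algebra over $k$, $M$ a left $H$-Hopf module with coaction $\rho$, and $T:M\to M$ a Hopf module map such that $(M,T)$ is a generic Rota-Baxter paired $H$-Hopf module of weight $\lambda$. Let $M^{coH}=\{m\in M\mid \rho(m)=1\otimes m\}$, and regard $H\otimes M^{coH}$ as a left $H$-Hopf module via $h\cdot(g\otimes m)=hg\otimes m$ and $h\otimes m\mapsto h_1\otimes h_2\otimes m$ for $h,g\in H$, $m\in M^{coH}$. Define $T'$ on $H\otimes M^{coH}$ by $T'(h\otimes m)=h\otimes T(m)$ for $h\in H$, $m\in M^{coH}$. Then there is an isomorphism $$(M,T)\cong(H\otimes M^{coH},T')$$ as generic Rota-Baxter paired left $H$-Hopf modules of weight $\lambda$.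
   Context: All spaces, maps and tensor products are over $k$; $\Delta(h)=h_1\otimes h_2$ (Sweedler notation). A left $H$-Hopf module is a left $H$-module and left $H$-comodule $M$, with coaction $\rho(m)=m_{(-1)}\otimes m_{(0)}$, such that $\rho(h\cdot m)=h_1m_{(-1)}\otimes h_2\cdot m_{(0)}$. A Hopf module map is an $H$-linear and $H$-colinear map. Let $P:H\to H$ and $T:M\to M$ be linear. $(M,P,T)$ is a Rota-Baxter paired left $H$-module of weight $\lambda$ if $P(h)\cdot T(m)=T(P(h)\cdot m)+T(h\cdot T(m))+\lambda T(h\cdot m)$ for all $h\in H,m\in M$. It is a Rota-Baxter paired left $H$-comodule of weight $\lambda$ if $(P\otimes T)\rho=(P\otimes\mathrm{id})\rho T+(\mathrm{id}\otimes T)\rho T+\lambda\rho T$. It is a Rota-Baxter paired left $H$-Hopf module of weight $\lambda$ if $M$ is a left $H$-Hopf module and both conditions hold. $(M,T)$ is a generic Rota-Baxter paired left $H$-Hopf module of weight $\lambda$ if $(M,P,T)$ is a Rota-Baxter paired left $H$-Hopf module of weight $\lambda$ for every linear $P:H\to H$. An isomorphism $(M,T)\cong(M',T')$ of generic Rota-Baxter paired left $H$-Hopf modules of weight $\lambda$ is a bijective Hopf module map $f:M\to M'$ with $f\circ T=T'\circ f$ (both sides being generic Rota-Baxter paired left $H$-Hopf modules of weight $\lambda$). *)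

theory Defs
  imports "HOL-Algebra.Module" "HOL-Algebra.AbelCoset"
begin

(* Vector spaces over K are HOL-Algebra modules; the fields mult and one of the underlying
   ring record play no role for a module and are left undefined in the constructions below. *)

section \<open>Linear maps\<close>

definition linear_maps ::
  "('k, 'r) ring_scheme \<Rightarrow> ('k, 'v, 'x) module_scheme \<Rightarrow> ('k, 'w, 'y) module_scheme \<Rightarrow> ('v \<Rightarrow> 'w) set"
  where "linear_maps K V W =
    {f \<in> carrier V \<rightarrow> carrier W.
       (\<forall>u\<in>carrier V. \<forall>v\<in>carrier V. f (u \<oplus>\<^bsub>V\<^esub> v) = f u \<oplus>\<^bsub>W\<^esub> f v) \<and>
       (\<forall>c\<in>carrier K. \<forall>v\<in>carrier V. f (c \<odot>\<^bsub>V\<^esub> v) = c \<odot>\<^bsub>W\<^esub> f v)}"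

definition bilinear_maps ::
  "('k, 'r) ring_scheme \<Rightarrow> ('k, 'v, 'x) module_scheme \<Rightarrow> ('k, 'w, 'y) module_scheme \<Rightarrow>
   ('k, 'u, 'z) module_scheme \<Rightarrow> ('v \<Rightarrow> 'w \<Rightarrow> 'u) set"
  where "bilinear_maps K V W U =
    {B. (\<forall>v\<in>carrier V. B v \<in> linear_maps K W U) \<and>
        (\<forall>w\<in>carrier W. (\<lambda>v. B v w) \<in> linear_maps K V U)}"

section \<open>Tensor products\<close>

definition free_module :: "('k, 'r) ring_scheme \<Rightarrow> 'a set \<Rightarrow> ('k, 'a \<Rightarrow> 'k) module"
  where "free_module K S =
    \<lparr>carrier = {f. (\<forall>p\<in>S. f p \<in> carrier K) \<and> (\<forall>p. p \<notin> S \<longrightarrow> f p = \<zero>\<^bsub>K\<^esub>) \<and>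
                   finite {p. f p \<noteq> \<zero>\<^bsub>K\<^esub>}},
     mult = undefined, one = undefined,
     zero = (\<lambda>p. \<zero>\<^bsub>K\<^esub>), add = (\<lambda>f g p. f p \<oplus>\<^bsub>K\<^esub> g p), smult = (\<lambda>c f p. c \<otimes>\<^bsub>K\<^esub> f p)\<rparr>"

definition free_gen :: "('k, 'r) ring_scheme \<Rightarrow> 'a \<Rightarrow> 'a \<Rightarrow> 'k"
  where "free_gen K p = (\<lambda>q. if q = p then \<one>\<^bsub>K\<^esub> else \<zero>\<^bsub>K\<^esub>)"

definition generated_submodule ::
  "('k, 'r) ring_scheme \<Rightarrow> ('k, 'v, 'x) module_scheme \<Rightarrow> 'v set \<Rightarrow> 'v set"
  where "generated_submodule K V A = \<Inter>{N. submodule N K V \<and> A \<subseteq> N}"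

definition quotient_module ::
  "('k, 'v, 'x) module_scheme \<Rightarrow> 'v set \<Rightarrow> ('k, 'v set) module"
  where "quotient_module V N =
    \<lparr>carrier = a_rcosets\<^bsub>V\<^esub> N, mult = undefined, one = undefined,
     zero = N, add = set_add V, smult = (\<lambda>c X. \<Union>x\<in>X. N +>\<^bsub>V\<^esub> (c \<odot>\<^bsub>V\<^esub> x))\<rparr>"

type_synonym ('k, 'v, 'w) tensor = "('v \<times> 'w \<Rightarrow> 'k) set"

definition tensor_relations ::
  "('k, 'r) ring_scheme \<Rightarrow> ('k, 'v, 'x) module_scheme \<Rightarrow> ('k, 'w, 'y) module_scheme \<Rightarrow>
   ('v \<times> 'w \<Rightarrow> 'k) set"
  where "tensor_relations K V W =
    (let F = free_module K (carrier V \<times> carrier W); e = (\<lambda>v w. free_gen K (v, w)) in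
     generated_submodule K F
      ({e (u \<oplus>\<^bsub>V\<^esub> v) w \<ominus>\<^bsub>F\<^esub> (e u w \<oplus>\<^bsub>F\<^esub> e v w) | u v w.
          u \<in> carrier V \<and> v \<in> carrier V \<and> w \<in> carrier W} \<union>
       {e v (w \<oplus>\<^bsub>W\<^esub> z) \<ominus>\<^bsub>F\<^esub> (e v w \<oplus>\<^bsub>F\<^esub> e v z) | v w z.
          v \<in> carrier V \<and> w \<in> carrier W \<and> z \<in> carrier W} \<union>
       {e (c \<odot>\<^bsub>V\<^esub> v) w \<ominus>\<^bsub>F\<^esub> (c \<odot>\<^bsub>F\<^esub> e v w) | c v w.
          c \<in> carrier K \<and> v \<in> carrier V \<and> w \<in> carrier W} \<union>
       {e v (c \<odot>\<^bsub>W\<^esub> w) \<ominus>\<^bsub>F\<^esub> (c \<odot>\<^bsub>F\<^esub> e v w) | c v w.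
          c \<in> carrier K \<and> v \<in> carrier V \<and> w \<in> carrier W}))"

definition tensor ::
  "('k, 'r) ring_scheme \<Rightarrow> ('k, 'v, 'x) module_scheme \<Rightarrow> ('k, 'w, 'y) module_scheme \<Rightarrow>
   ('k, ('k, 'v, 'w) tensor) module"
  where "tensor K V W =
    quotient_module (free_module K (carrier V \<times> carrier W)) (tensor_relations K V W)"

definition pure_tensor ::
  "('k, 'r) ring_scheme \<Rightarrow> ('k, 'v, 'x) module_scheme \<Rightarrow> ('k, 'w, 'y) module_scheme \<Rightarrow>
   'v \<Rightarrow> 'w \<Rightarrow> ('k, 'v, 'w) tensor"
  where "pure_tensor K V W v w =
    tensor_relations K V W +>\<^bsub>free_module K (carrier V \<times> carrier W)\<^esub> free_gen K (v, w)"

(* The linear map V \<otimes> W \<rightarrow> U induced by a bilinear map B: the class of \<Sum> c_i (v_i, w_i) is sent to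
   \<Sum> c_i B(v_i, w_i). In Sweedler notation tensor_lift K V W U B (\<Delta> h) is \<Sum> B(h_1, h_2).
   For bilinear B the chosen representative f does not matter. *)
definition tensor_lift ::
  "('k, 'r) ring_scheme \<Rightarrow> ('k, 'v, 'x) module_scheme \<Rightarrow> ('k, 'w, 'y) module_scheme \<Rightarrow>
   ('k, 'u, 'z) module_scheme \<Rightarrow> ('v \<Rightarrow> 'w \<Rightarrow> 'u) \<Rightarrow> ('k, 'v, 'w) tensor \<Rightarrow> 'u"
  where "tensor_lift K V W U B X =
    (let f = (SOME f. f \<in> X) in
     \<Oplus>\<^bsub>U\<^esub>p\<in>{p. f p \<noteq> \<zero>\<^bsub>K\<^esub>}. f p \<odot>\<^bsub>U\<^esub> B (fst p) (snd p))"

(* f \<otimes> g : V \<otimes> W \<rightarrow> V' \<otimes> W' *)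
definition tensor_map ::
  "('k, 'r) ring_scheme \<Rightarrow> ('k, 'v, 'x) module_scheme \<Rightarrow> ('k, 'w, 'y) module_scheme \<Rightarrow>
   ('k, 'v2, 'x2) module_scheme \<Rightarrow> ('k, 'w2, 'y2) module_scheme \<Rightarrow>
   ('v \<Rightarrow> 'v2) \<Rightarrow> ('w \<Rightarrow> 'w2) \<Rightarrow> ('k, 'v, 'w) tensor \<Rightarrow> ('k, 'v2, 'w2) tensor"
  where "tensor_map K V W V' W' f g =
    tensor_lift K V W (tensor K V' W') (\<lambda>v w. pure_tensor K V' W' (f v) (g w))"

(* (U \<otimes> V) \<otimes> W \<rightarrow> U \<otimes> (V \<otimes> W) *)
definition tensor_assoc ::
  "('k, 'r) ring_scheme \<Rightarrow> ('k, 'u, 'x) module_scheme \<Rightarrow> ('k, 'v, 'y) module_scheme \<Rightarrow>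
   ('k, 'w, 'z) module_scheme \<Rightarrow>
   ('k, ('k, 'u, 'v) tensor, 'w) tensor \<Rightarrow> ('k, 'u, ('k, 'v, 'w) tensor) tensor"
  where "tensor_assoc K U V W =
    tensor_lift K (tensor K U V) W (tensor K U (tensor K V W))
      (\<lambda>x w. tensor_lift K U V (tensor K U (tensor K V W))
        (\<lambda>u v. pure_tensor K U (tensor K V W) u (pure_tensor K V W v w)) x)"

(* The bilinear map (A \<otimes> V) \<times> (A' \<otimes> W) \<rightarrow> B \<otimes> U with (a \<otimes> v, a' \<otimes> w) \<mapsto> \<mu>(a, a') \<otimes> \<nu>(v, w). *)
definition tensor_prod ::
  "('k, 'r) ring_scheme \<Rightarrow> ('k, 'a, 'x1) module_scheme \<Rightarrow> ('k, 'v, 'x2) module_scheme \<Rightarrow>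
   ('k, 'a2, 'x3) module_scheme \<Rightarrow> ('k, 'w, 'x4) module_scheme \<Rightarrow>
   ('k, 'b, 'x5) module_scheme \<Rightarrow> ('k, 'u, 'x6) module_scheme \<Rightarrow>
   ('a \<Rightarrow> 'a2 \<Rightarrow> 'b) \<Rightarrow> ('v \<Rightarrow> 'w \<Rightarrow> 'u) \<Rightarrow>
   ('k, 'a, 'v) tensor \<Rightarrow> ('k, 'a2, 'w) tensor \<Rightarrow> ('k, 'b, 'u) tensor"
  where "tensor_prod K A V A' W B U \<mu> \<nu> x y =
    tensor_lift K A V (tensor K B U)
      (\<lambda>a v. tensor_lift K A' W (tensor K B U)
        (\<lambda>a' w. pure_tensor K B U (\<mu> a a') (\<nu> v w)) y) x"

section \<open>Hopf algebras\<close>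

(* HOL-Algebra's locale algebra is restricted to commutative algebras. *)
definition assoc_algebra :: "('k, 'r) ring_scheme \<Rightarrow> ('k, 'a, 'x) module_scheme \<Rightarrow> bool"
  where "assoc_algebra K A \<longleftrightarrow> module K A \<and> ring A \<and>
    (\<forall>c\<in>carrier K. \<forall>x\<in>carrier A. \<forall>y\<in>carrier A.
       (c \<odot>\<^bsub>A\<^esub> x) \<otimes>\<^bsub>A\<^esub> y = c \<odot>\<^bsub>A\<^esub> (x \<otimes>\<^bsub>A\<^esub> y) \<and>
       x \<otimes>\<^bsub>A\<^esub> (c \<odot>\<^bsub>A\<^esub> y) = c \<odot>\<^bsub>A\<^esub> (x \<otimes>\<^bsub>A\<^esub> y))"

definition tensor_algebra ::
  "('k, 'r) ring_scheme \<Rightarrow> ('k, 'a, 'x) module_scheme \<Rightarrow> ('k, 'b, 'y) module_scheme \<Rightarrow>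
   ('k, ('k, 'a, 'b) tensor) module"
  where "tensor_algebra K A B =
    (tensor K A B)\<lparr>mult := tensor_prod K A B A B A B (mult A) (mult B),
                   one := pure_tensor K A B \<one>\<^bsub>A\<^esub> \<one>\<^bsub>B\<^esub>\<rparr>"

record ('k, 'h) hopf_alg = "('k, 'h) module" +
  comult :: "'h \<Rightarrow> ('k, 'h, 'h) tensor"
  counit :: "'h \<Rightarrow> 'k"
  antipode :: "'h \<Rightarrow> 'h"

definition coalgebra :: "('k, 'r) ring_scheme \<Rightarrow> ('k, 'h, 'x) hopf_alg_scheme \<Rightarrow> bool"
  where "coalgebra K H \<longleftrightarrow> module K H \<and>
    comult H \<in> linear_maps K H (tensor K H H) \<and>
    counit H \<in> carrier H \<rightarrow> carrier K \<and>
    (\<forall>g\<in>carrier H. \<forall>h\<in>carrier H. counit H (g \<oplus>\<^bsub>H\<^esub> h) = counit H g \<oplus>\<^bsub>K\<^esub> counit H h) \<and>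
    (\<forall>c\<in>carrier K. \<forall>h\<in>carrier H. counit H (c \<odot>\<^bsub>H\<^esub> h) = c \<otimes>\<^bsub>K\<^esub> counit H h) \<and>
    (\<forall>h\<in>carrier H.
       tensor_assoc K H H H
         (tensor_map K H H (tensor K H H) H (comult H) (\<lambda>x. x) (comult H h)) =
       tensor_map K H H H (tensor K H H) (\<lambda>x. x) (comult H) (comult H h)) \<and>
    (\<forall>h\<in>carrier H. tensor_lift K H H H (\<lambda>a b. counit H a \<odot>\<^bsub>H\<^esub> b) (comult H h) = h) \<and>
    (\<forall>h\<in>carrier H. tensor_lift K H H H (\<lambda>a b. counit H b \<odot>\<^bsub>H\<^esub> a) (comult H h) = h)"

definition bialgebra :: "('k, 'r) ring_scheme \<Rightarrow> ('k, 'h, 'x) hopf_alg_scheme \<Rightarrow> bool"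
  where "bialgebra K H \<longleftrightarrow> assoc_algebra K H \<and> coalgebra K H \<and>
    comult H \<in> ring_hom H (tensor_algebra K H H) \<and> counit H \<in> ring_hom H K"

definition hopf_algebra :: "('k, 'r) ring_scheme \<Rightarrow> ('k, 'h, 'x) hopf_alg_scheme \<Rightarrow> bool"
  where "hopf_algebra K H \<longleftrightarrow> bialgebra K H \<and> antipode H \<in> linear_maps K H H \<and>
    (\<forall>h\<in>carrier H.
       tensor_lift K H H H (\<lambda>a b. antipode H a \<otimes>\<^bsub>H\<^esub> b) (comult H h) = counit H h \<odot>\<^bsub>H\<^esub> \<one>\<^bsub>H\<^esub> \<and>
       tensor_lift K H H H (\<lambda>a b. a \<otimes>\<^bsub>H\<^esub> antipode H b) (comult H h) = counit H h \<odot>\<^bsub>H\<^esub> \<one>\<^bsub>H\<^esub>)"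

section \<open>Hopf modules\<close>

record ('k, 'h, 'm) hopf_mod = "('k, 'm) module" +
  act :: "'h \<Rightarrow> 'm \<Rightarrow> 'm"
  coact :: "'m \<Rightarrow> ('k, 'h, 'm) tensor"

definition left_module ::
  "('k, 'r) ring_scheme \<Rightarrow> ('k, 'h, 'x) hopf_alg_scheme \<Rightarrow> ('k, 'h, 'm, 'y) hopf_mod_scheme \<Rightarrow> bool"
  where "left_module K H M \<longleftrightarrow> module K M \<and> act M \<in> bilinear_maps K H M M \<and>
    (\<forall>g\<in>carrier H. \<forall>h\<in>carrier H. \<forall>m\<in>carrier M. act M (g \<otimes>\<^bsub>H\<^esub> h) m = act M g (act M h m)) \<and>
    (\<forall>m\<in>carrier M. act M \<one>\<^bsub>H\<^esub> m = m)"

definition left_comodule ::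
  "('k, 'r) ring_scheme \<Rightarrow> ('k, 'h, 'x) hopf_alg_scheme \<Rightarrow> ('k, 'h, 'm, 'y) hopf_mod_scheme \<Rightarrow> bool"
  where "left_comodule K H M \<longleftrightarrow> module K M \<and> coact M \<in> linear_maps K M (tensor K H M) \<and>
    (\<forall>m\<in>carrier M.
       tensor_assoc K H H M
         (tensor_map K H M (tensor K H H) M (comult H) (\<lambda>x. x) (coact M m)) =
       tensor_map K H M H (tensor K H M) (\<lambda>x. x) (coact M) (coact M m)) \<and>
    (\<forall>m\<in>carrier M. tensor_lift K H M M (\<lambda>h n. counit H h \<odot>\<^bsub>M\<^esub> n) (coact M m) = m)"

definition hopf_module ::
  "('k, 'r) ring_scheme \<Rightarrow> ('k, 'h, 'x) hopf_alg_scheme \<Rightarrow> ('k, 'h, 'm, 'y) hopf_mod_scheme \<Rightarrow> bool"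
  where "hopf_module K H M \<longleftrightarrow> left_module K H M \<and> left_comodule K H M \<and>
    (\<forall>h\<in>carrier H. \<forall>m\<in>carrier M.
       coact M (act M h m) =
       tensor_prod K H H H M H M (mult H) (act M) (comult H h) (coact M m))"

definition hopf_module_maps ::
  "('k, 'r) ring_scheme \<Rightarrow> ('k, 'h, 'x) hopf_alg_scheme \<Rightarrow> ('k, 'h, 'm, 'y) hopf_mod_scheme \<Rightarrow>
   ('k, 'h, 'n, 'z) hopf_mod_scheme \<Rightarrow> ('m \<Rightarrow> 'n) set"
  where "hopf_module_maps K H M N =
    {f \<in> linear_maps K M N.
       (\<forall>h\<in>carrier H. \<forall>m\<in>carrier M. f (act M h m) = act N h (f m)) \<and>
       (\<forall>m\<in>carrier M. coact N (f m) = tensor_map K H M H N (\<lambda>x. x) f (coact M m))}"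

definition coinvariants ::
  "('k, 'r) ring_scheme \<Rightarrow> ('k, 'h, 'x) hopf_alg_scheme \<Rightarrow> ('k, 'h, 'm, 'y) hopf_mod_scheme \<Rightarrow> 'm set"
  where "coinvariants K H M = {m \<in> carrier M. coact M m = pure_tensor K H M \<one>\<^bsub>H\<^esub> m}"

definition coinvariant_space ::
  "('k, 'r) ring_scheme \<Rightarrow> ('k, 'h, 'x) hopf_alg_scheme \<Rightarrow> ('k, 'h, 'm, 'y) hopf_mod_scheme \<Rightarrow>
   ('k, 'm) module"
  where "coinvariant_space K H M = module.truncate (M\<lparr>carrier := coinvariants K H M\<rparr>)"

(* H \<otimes> V for a vector space V, with h \<cdot> (g \<otimes> v) = hg \<otimes> v and h \<otimes> v \<mapsto> h_1 \<otimes> (h_2 \<otimes> v). *)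
definition free_hopf_module ::
  "('k, 'r) ring_scheme \<Rightarrow> ('k, 'h, 'x) hopf_alg_scheme \<Rightarrow> ('k, 'v, 'y) module_scheme \<Rightarrow>
   ('k, 'h, ('k, 'h, 'v) tensor) hopf_mod"
  where "free_hopf_module K H V =
    module.extend (tensor K H V)
      (hopf_mod.fields
        (\<lambda>h. tensor_map K H V H V (\<lambda>g. h \<otimes>\<^bsub>H\<^esub> g) (\<lambda>v. v))
        (\<lambda>x. tensor_assoc K H H V (tensor_map K H V (tensor K H H) V (comult H) (\<lambda>v. v) x)))"

section \<open>Rota-Baxter paired Hopf modules\<close>

definition rb_paired_module ::
  "('k, 'r) ring_scheme \<Rightarrow> ('k, 'h, 'x) hopf_alg_scheme \<Rightarrow> 'k \<Rightarrow> ('k, 'h, 'm, 'y) hopf_mod_scheme \<Rightarrow>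
   ('h \<Rightarrow> 'h) \<Rightarrow> ('m \<Rightarrow> 'm) \<Rightarrow> bool"
  where "rb_paired_module K H lam M P T \<longleftrightarrow>
    left_module K H M \<and> P \<in> linear_maps K H H \<and> T \<in> linear_maps K M M \<and>
    (\<forall>h\<in>carrier H. \<forall>m\<in>carrier M.
       act M (P h) (T m) =
       T (act M (P h) m) \<oplus>\<^bsub>M\<^esub> T (act M h (T m)) \<oplus>\<^bsub>M\<^esub> lam \<odot>\<^bsub>M\<^esub> T (act M h m))"

definition rb_paired_comodule ::
  "('k, 'r) ring_scheme \<Rightarrow> ('k, 'h, 'x) hopf_alg_scheme \<Rightarrow> 'k \<Rightarrow> ('k, 'h, 'm, 'y) hopf_mod_scheme \<Rightarrow>
   ('h \<Rightarrow> 'h) \<Rightarrow> ('m \<Rightarrow> 'm) \<Rightarrow> bool"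
  where "rb_paired_comodule K H lam M P T \<longleftrightarrow>
    left_comodule K H M \<and> P \<in> linear_maps K H H \<and> T \<in> linear_maps K M M \<and>
    (\<forall>m\<in>carrier M.
       tensor_map K H M H M P T (coact M m) =
       tensor_map K H M H M P (\<lambda>x. x) (coact M (T m)) \<oplus>\<^bsub>tensor K H M\<^esub>
       tensor_map K H M H M (\<lambda>x. x) T (coact M (T m)) \<oplus>\<^bsub>tensor K H M\<^esub>
       lam \<odot>\<^bsub>tensor K H M\<^esub> coact M (T m))"

definition rb_paired_hopf_module ::
  "('k, 'r) ring_scheme \<Rightarrow> ('k, 'h, 'x) hopf_alg_scheme \<Rightarrow> 'k \<Rightarrow> ('k, 'h, 'm, 'y) hopf_mod_scheme \<Rightarrow>
   ('h \<Rightarrow> 'h) \<Rightarrow> ('m \<Rightarrow> 'm) \<Rightarrow> bool"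
  where "rb_paired_hopf_module K H lam M P T \<longleftrightarrow>
    hopf_module K H M \<and> rb_paired_module K H lam M P T \<and> rb_paired_comodule K H lam M P T"

definition generic_rb_hopf_module ::
  "('k, 'r) ring_scheme \<Rightarrow> ('k, 'h, 'x) hopf_alg_scheme \<Rightarrow> 'k \<Rightarrow> ('k, 'h, 'm, 'y) hopf_mod_scheme \<Rightarrow>
   ('m \<Rightarrow> 'm) \<Rightarrow> bool"
  where "generic_rb_hopf_module K H lam M T \<longleftrightarrow>
    (\<forall>P \<in> linear_maps K H H. rb_paired_hopf_module K H lam M P T)"

definition generic_rb_isomorphic ::
  "('k, 'r) ring_scheme \<Rightarrow> ('k, 'h, 'x) hopf_alg_scheme \<Rightarrow> 'k \<Rightarrow>
   ('k, 'h, 'm, 'y) hopf_mod_scheme \<Rightarrow> ('m \<Rightarrow> 'm) \<Rightarrow>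
   ('k, 'h, 'n, 'z) hopf_mod_scheme \<Rightarrow> ('n \<Rightarrow> 'n) \<Rightarrow> bool"
  where "generic_rb_isomorphic K H lam M T M' T' \<longleftrightarrow>
    generic_rb_hopf_module K H lam M T \<and> generic_rb_hopf_module K H lam M' T' \<and>
    (\<exists>f \<in> hopf_module_maps K H M M'. bij_betw f (carrier M) (carrier M') \<and>
       (\<forall>m\<in>carrier M. f (T m) = T' (f m)))"

end

(* For a Hopf module map T, taking P = id in the module condition shows that (M, T) is generic iff
   T^2 + lam T = 0, and this identity is transported along any isomorphism commuting with T and T'.

   Such an isomorphism is m |-> m_(-1) (x) E(m_(0)) with E(m) = S(m_(-1)) m_(0); its inverse is
   h (x) v |-> h v. That E(m) is coinvariant is seen without the anti-comultiplicativity of S: for a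
   left H-module N the operator phi |-> (m |-> m_(-1) phi(m_(0))) on linear maps M -> N is
   injective (S gives the inverse), and for N = H (x) M with the diagonal action it sends both
   rho E and 1 (x) E to rho. *)
theory Submission
  imports Defs
begin

section \<open>Quotients of modules\<close>

text \<open>Elements of a tensor product are cosets, and a Sweedler sum is
  \<open>tensor_lift\<close> of a bilinear map at one arbitrarily chosen representative, so
  components such as m_(-1) and m_(0) never exist as terms. Every manipulation of them is one of
  four moves: compare on pure tensors (\<open>tensor_ext\<close>), rewrite a summand
  (\<open>tensor_lift_cong\<close>), move a linear map through the sum
  (\<open>linear_map_lift\<close>), reassociate a double sum (\<open>coassoc_lift\<close>). The side
  conditions on linearity mostly fall to the rules in \<open>linear_intros\<close>. The usual proof
  that E(m) is coinvariant expands rho(S(m_(-1)) m_(0)) by Delta(S(h)) = S(h_2) (x) S(h_1), which is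
  not an axiom and would cost a separate convolution argument in H (x) H. The injectivity argument
  needs no new computation with S: it rests on \<open>convolution_cancel\<close>, the same lemma
  that gives m_(-1) E(m_(0)) = m. Genericity quantifies over all P, but when T is H-linear and
  H-colinear the terms containing P cancel on both sides, so that only T^2 + lam T = 0 is
  left.\<close>

lemma (in module) submodule_Inter:
  assumes "\<A> \<noteq> {}" and "\<And>N. N \<in> \<A> \<Longrightarrow> submodule N R M"
  shows "submodule (\<Inter>\<A>) R M"
proof (rule submoduleI)
  show "\<Inter>\<A> \<subseteq> carrier M" using assms submoduleE(1) by blast
  show "\<zero>\<^bsub>M\<^esub> \<in> \<Inter>\<A>"
    using assms(2) subgroup.one_closed[OF submodule.axioms(1)] by fastforce
qed (use assms(2) submoduleE(3-5)[OF assms(2)] in auto)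

lemma (in module) generated_submodule_submodule:
  assumes "A \<subseteq> carrier M"
  shows "submodule (generated_submodule R M A) R M"
  unfolding generated_submodule_def
  by (rule submodule_Inter) (use assms carrier_is_submodule in auto)

lemma generated_submodule_incl: "A \<subseteq> generated_submodule K V A"
  unfolding generated_submodule_def by blast

lemma generated_submodule_least:
  "submodule N K V \<Longrightarrow> A \<subseteq> N \<Longrightarrow> generated_submodule K V A \<subseteq> N"
  unfolding generated_submodule_def by blast

context module
begin

context
  fixes N
  assumes N: "submodule N R M"
begin

lemma submodule_abelian_subgroup: "abelian_subgroup N M"
  by (rule abelian_subgroupI3[OF additive_subgroupI[OF submodule.axioms(1)[OF N]]
        M.abelian_group_axioms])

lemma coset_eq_iff:
  assumes "x \<in> carrier M" "y \<in> carrier M"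
  shows "N +>\<^bsub>M\<^esub> x = N +>\<^bsub>M\<^esub> y \<longleftrightarrow> x \<ominus>\<^bsub>M\<^esub> y \<in> N"
proof -
  interpret N: abelian_subgroup N M by (rule submodule_abelian_subgroup)
  let ?d = "x \<oplus>\<^bsub>M\<^esub> \<ominus>\<^bsub>M\<^esub> y"
  have d: "?d \<in> carrier M" using assms by simp
  have "N +>\<^bsub>M\<^esub> x = N +>\<^bsub>M\<^esub> y \<longleftrightarrow> N +>\<^bsub>M\<^esub> ?d = N"
    using M.a_coset_add_inv1[OF _ assms N.a_subset] M.a_coset_add_inv2[OF _ assms N.a_subset] by metis
  also have "\<dots> \<longleftrightarrow> ?d \<in> N"
    using M.a_coset_join1[OF _ d N.a_subgroup] M.a_coset_join2[OF d N.a_subgroup] by metis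
  finally show ?thesis by (simp add: a_minus_def)
qed

lemma coset_memD:
  assumes "x \<in> carrier M" "y \<in> N +>\<^bsub>M\<^esub> x"
  obtains n where "n \<in> N" "y = n \<oplus>\<^bsub>M\<^esub> x"
  using assms(2) unfolding a_r_coset_def' by auto

lemma coset_self:
  assumes "x \<in> carrier M"
  shows "x \<in> N +>\<^bsub>M\<^esub> x"
proof -
  interpret N: abelian_subgroup N M by (rule submodule_abelian_subgroup)
  show ?thesis by (rule N.a_rcos_self[OF assms])
qed

lemma quotient_add:
  assumes "x \<in> carrier M" "y \<in> carrier M"
  shows "(N +>\<^bsub>M\<^esub> x) \<oplus>\<^bsub>quotient_module M N\<^esub> (N +>\<^bsub>M\<^esub> y) = N +>\<^bsub>M\<^esub> (x \<oplus>\<^bsub>M\<^esub> y)"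
proof -
  interpret N: abelian_subgroup N M by (rule submodule_abelian_subgroup)
  show ?thesis using N.a_rcos_sum[OF assms] by (simp add: quotient_module_def)
qed

text \<open>The product with a coset is a union over all its elements. The union collapses because
  every element n + x contributes the same coset: c (n + x) and c x differ by c n, which lies in
  N.\<close>

lemma quotient_smult:
  assumes c: "c \<in> carrier R" and x: "x \<in> carrier M"
  shows "c \<odot>\<^bsub>quotient_module M N\<^esub> (N +>\<^bsub>M\<^esub> x) = N +>\<^bsub>M\<^esub> (c \<odot>\<^bsub>M\<^esub> x)"
proof -
  have "N +>\<^bsub>M\<^esub> (c \<odot>\<^bsub>M\<^esub> z) = N +>\<^bsub>M\<^esub> (c \<odot>\<^bsub>M\<^esub> x)" if z: "z \<in> N +>\<^bsub>M\<^esub> x" for z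
  proof -
    obtain n where n: "n \<in> N" "z = n \<oplus>\<^bsub>M\<^esub> x" using coset_memD[OF x z] .
    have nM: "n \<in> carrier M" using n(1) submoduleE(1)[OF N] by blast
    have "c \<odot>\<^bsub>M\<^esub> z \<ominus>\<^bsub>M\<^esub> c \<odot>\<^bsub>M\<^esub> x = c \<odot>\<^bsub>M\<^esub> n"
      using c x nM n by (simp add: smult_r_distr a_minus_def M.a_assoc M.r_neg)
    also have "\<dots> \<in> N" using submoduleE(4)[OF N c n(1)] .
    finally show ?thesis using coset_eq_iff c x nM n by simp
  qed
  note eq = this
  show ?thesis
    unfolding quotient_module_def module.simps
    by (rule UN_constant_eq[OF coset_self[OF x]]) (intro ballI eq)
qed

lemma quotient_carrier: "carrier (quotient_module M N) = (\<lambda>x. N +>\<^bsub>M\<^esub> x) ` carrier M"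
  by (auto simp: quotient_module_def A_RCOSETS_def')

lemma quotient_zero: "\<zero>\<^bsub>quotient_module M N\<^esub> = N +>\<^bsub>M\<^esub> \<zero>\<^bsub>M\<^esub>"
  using submoduleE(1)[OF N] by (simp add: quotient_module_def)

lemma quotient_module_module: "module R (quotient_module M N)"
proof (rule moduleI)
  show "cring R" by (rule R.is_cring)
  show "abelian_group (quotient_module M N)"
  proof (rule abelian_groupI)
    fix X assume "X \<in> carrier (quotient_module M N)"
    then obtain x where x: "x \<in> carrier M" "X = N +>\<^bsub>M\<^esub> x" by (auto simp: quotient_carrier)
    show "\<exists>Y\<in>carrier (quotient_module M N). Y \<oplus>\<^bsub>quotient_module M N\<^esub> X = \<zero>\<^bsub>quotient_module M N\<^esub>"
      using x by (intro bexI[of _ "N +>\<^bsub>M\<^esub> (\<ominus>\<^bsub>M\<^esub> x)"])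
        (auto simp: quotient_carrier quotient_add quotient_zero M.l_neg)
  qed (auto simp: quotient_carrier quotient_add quotient_zero M.a_ac)
qed (auto simp: quotient_carrier quotient_add quotient_smult smult_l_distr smult_r_distr smult_assoc1)

end

end

section \<open>Free modules\<close>

context cring
begin

lemma free_module_memD:
  assumes "f \<in> carrier (free_module R S)"
  shows "f p \<in> carrier R" and "p \<notin> S \<Longrightarrow> f p = \<zero>" and "finite {p. f p \<noteq> \<zero>}"
    and "{p. f p \<noteq> \<zero>} \<subseteq> S"
  using assms by (auto simp: free_module_def)

lemma free_module_module: "module R (free_module R S)"
proof -
  let ?F = "free_module R S"
  have add: "(\<lambda>p. f p \<oplus> g p) \<in> carrier ?F" if "f \<in> carrier ?F" "g \<in> carrier ?F" for f g
  proof -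
    have "{p. f p \<oplus> g p \<noteq> \<zero>} \<subseteq> {p. f p \<noteq> \<zero>} \<union> {p. g p \<noteq> \<zero>}" by auto
    then show ?thesis using that by (auto simp: free_module_def elim: finite_subset)
  qed
  have smult: "(\<lambda>p. c \<otimes> f p) \<in> carrier ?F" if "c \<in> carrier R" "f \<in> carrier ?F" for c f
  proof -
    have "{p. c \<otimes> f p \<noteq> \<zero>} \<subseteq> {p. f p \<noteq> \<zero>}" using that by auto
    then show ?thesis using that by (auto simp: free_module_def elim: finite_subset)
  qed
  have val: "f p \<in> carrier R" if "f \<in> carrier ?F" for f p
    using free_module_memD(1)[OF that] .
  have zero: "(\<lambda>p. \<zero>) \<in> carrier ?F" by (simp add: free_module_def)
  have sel: "\<zero>\<^bsub>?F\<^esub> = (\<lambda>p. \<zero>)" "f \<oplus>\<^bsub>?F\<^esub> g = (\<lambda>p. f p \<oplus> g p)" "c \<odot>\<^bsub>?F\<^esub> f = (\<lambda>p. c \<otimes> f p)" for c f g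
    by (simp_all add: free_module_def)
  show ?thesis
  proof (rule moduleI)
    show "cring R" by (rule is_cring)
    show "abelian_group ?F"
    proof (rule abelian_groupI)
      fix f assume f: "f \<in> carrier ?F"
      \<comment> \<open>Taking the additive inverse as the multiple by minus one lets the closure
        fact \<open>smult\<close> supply its finite support.\<close>
      have "(\<lambda>p. \<ominus> \<one> \<otimes> f p) \<in> carrier ?F" using f by (intro smult) auto
      moreover have "(\<lambda>p. \<ominus> \<one> \<otimes> f p) \<oplus>\<^bsub>?F\<^esub> f = \<zero>\<^bsub>?F\<^esub>"
        using val[OF f] by (simp add: sel l_minus l_neg)
      ultimately show "\<exists>g\<in>carrier ?F. g \<oplus>\<^bsub>?F\<^esub> f = \<zero>\<^bsub>?F\<^esub>" by blast
    qed (simp_all add: sel add zero val a_ac)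
  qed (simp_all add: sel smult val l_distr r_distr m_assoc)
qed

lemma free_gen_closed: "p \<in> S \<Longrightarrow> free_gen R p \<in> carrier (free_module R S)"
  by (auto simp: free_module_def free_gen_def)

end

text \<open>\<open>tensor_lift\<close> evaluates this functional at a representative.\<close>

definition free_lift ::
  "('k, 'r) ring_scheme \<Rightarrow> ('k, 'u, 'z) module_scheme \<Rightarrow> ('a \<Rightarrow> 'u) \<Rightarrow> ('a \<Rightarrow> 'k) \<Rightarrow> 'u"
  where "free_lift K U b f = (\<Oplus>\<^bsub>U\<^esub>p\<in>{p. f p \<noteq> \<zero>\<^bsub>K\<^esub>}. f p \<odot>\<^bsub>U\<^esub> b p)"

context module
begin

text \<open>The defining sum runs over the support, which differs between f, g and f + g. Padding
  with zero terms brings all of them to one common finite index set.\<close>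

lemma free_lift_superset:
  assumes "f \<in> carrier (free_module R S)" "b \<in> S \<rightarrow> carrier M"
    and "finite A" "{p. f p \<noteq> \<zero>} \<subseteq> A" "A \<subseteq> S"
  shows "free_lift R M b f = (\<Oplus>\<^bsub>M\<^esub>p\<in>A. f p \<odot>\<^bsub>M\<^esub> b p)"
  unfolding free_lift_def
  by (rule M.add.finprod_mono_neutral_cong_left)
    (use assms R.free_module_memD[OF assms(1)] in \<open>auto simp: Pi_iff subset_iff\<close>)

lemma free_lift_linear:
  assumes b: "b \<in> S \<rightarrow> carrier M"
  shows "free_lift R M b \<in> linear_maps R (free_module R S) M"
proof -
  let ?F = "free_module R S"
  interpret F: module R ?F by (rule R.free_module_module)
  have cl: "(\<lambda>p. f p \<odot>\<^bsub>M\<^esub> b p) \<in> A \<rightarrow> carrier M" if "f \<in> carrier ?F" "A \<subseteq> S" for f A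
    using that b R.free_module_memD(1)[OF that(1)] by (auto simp: Pi_iff subset_iff)
  have "free_lift R M b f \<in> carrier M" if f: "f \<in> carrier ?F" for f
    unfolding free_lift_def by (rule M.finsum_closed) (rule cl[OF f R.free_module_memD(4)[OF f]])
  moreover have "free_lift R M b (f \<oplus>\<^bsub>?F\<^esub> g) = free_lift R M b f \<oplus>\<^bsub>M\<^esub> free_lift R M b g"
    if f: "f \<in> carrier ?F" and g: "g \<in> carrier ?F" for f g
  proof -
    let ?A = "{p. f p \<noteq> \<zero>} \<union> {p. g p \<noteq> \<zero>}"
    have A: "finite ?A" "?A \<subseteq> S"
      using R.free_module_memD(3,4)[OF f] R.free_module_memD(3,4)[OF g] by auto
    have fg: "(f \<oplus>\<^bsub>?F\<^esub> g) p = f p \<oplus> g p" for p by (simp add: free_module_def)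
    have "free_lift R M b (f \<oplus>\<^bsub>?F\<^esub> g) = (\<Oplus>\<^bsub>M\<^esub>p\<in>?A. (f \<oplus>\<^bsub>?F\<^esub> g) p \<odot>\<^bsub>M\<^esub> b p)"
      by (rule free_lift_superset[OF _ b A(1) _ A(2)]) (use f g fg in auto)
    also have "\<dots> = (\<Oplus>\<^bsub>M\<^esub>p\<in>?A. f p \<odot>\<^bsub>M\<^esub> b p \<oplus>\<^bsub>M\<^esub> g p \<odot>\<^bsub>M\<^esub> b p)"
    proof (rule M.finsum_cong'[OF refl])
      show "(\<lambda>p. f p \<odot>\<^bsub>M\<^esub> b p \<oplus>\<^bsub>M\<^esub> g p \<odot>\<^bsub>M\<^esub> b p) \<in> ?A \<rightarrow> carrier M"
        using cl[OF f A(2)] cl[OF g A(2)] by (auto simp: Pi_iff)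
      fix p assume "p \<in> ?A"
      then have "b p \<in> carrier M" using A(2) b by blast
      then show "(f \<oplus>\<^bsub>?F\<^esub> g) p \<odot>\<^bsub>M\<^esub> b p = f p \<odot>\<^bsub>M\<^esub> b p \<oplus>\<^bsub>M\<^esub> g p \<odot>\<^bsub>M\<^esub> b p"
        using R.free_module_memD(1)[OF f] R.free_module_memD(1)[OF g] by (simp add: fg smult_l_distr)
    qed
    also have "\<dots> = (\<Oplus>\<^bsub>M\<^esub>p\<in>?A. f p \<odot>\<^bsub>M\<^esub> b p) \<oplus>\<^bsub>M\<^esub> (\<Oplus>\<^bsub>M\<^esub>p\<in>?A. g p \<odot>\<^bsub>M\<^esub> b p)"
      by (rule M.finsum_addf) (use cl[OF f A(2)] cl[OF g A(2)] in auto)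
    also have "\<dots> = free_lift R M b f \<oplus>\<^bsub>M\<^esub> free_lift R M b g"
      using free_lift_superset[OF f b A(1) _ A(2)] free_lift_superset[OF g b A(1) _ A(2)] by simp
    finally show ?thesis .
  qed
  moreover have "free_lift R M b (c \<odot>\<^bsub>?F\<^esub> f) = c \<odot>\<^bsub>M\<^esub> free_lift R M b f"
    if c: "c \<in> carrier R" and f: "f \<in> carrier ?F" for c f
  proof -
    let ?A = "{p. f p \<noteq> \<zero>}"
    have A: "finite ?A" "?A \<subseteq> S" using R.free_module_memD(3,4)[OF f] by auto
    have cf: "(c \<odot>\<^bsub>?F\<^esub> f) p = c \<otimes> f p" for p by (simp add: free_module_def)
    have "free_lift R M b (c \<odot>\<^bsub>?F\<^esub> f) = (\<Oplus>\<^bsub>M\<^esub>p\<in>?A. (c \<odot>\<^bsub>?F\<^esub> f) p \<odot>\<^bsub>M\<^esub> b p)"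
      by (rule free_lift_superset[OF _ b A(1) _ A(2)]) (use c f cf in auto)
    also have "\<dots> = (\<Oplus>\<^bsub>M\<^esub>p\<in>?A. c \<odot>\<^bsub>M\<^esub> (f p \<odot>\<^bsub>M\<^esub> b p))"
    proof (rule M.finsum_cong'[OF refl])
      show "(\<lambda>p. c \<odot>\<^bsub>M\<^esub> (f p \<odot>\<^bsub>M\<^esub> b p)) \<in> ?A \<rightarrow> carrier M"
        using cl[OF f A(2)] c by (auto simp: Pi_iff)
      fix p assume "p \<in> ?A"
      then have "b p \<in> carrier M" using A(2) b by blast
      then show "(c \<odot>\<^bsub>?F\<^esub> f) p \<odot>\<^bsub>M\<^esub> b p = c \<odot>\<^bsub>M\<^esub> (f p \<odot>\<^bsub>M\<^esub> b p)"
        using R.free_module_memD(1)[OF f] c by (simp add: cf smult_assoc1)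
    qed
    also have "\<dots> = c \<odot>\<^bsub>M\<^esub> free_lift R M b f"
      unfolding free_lift_def
      by (rule finsum_smult_ldistr[symmetric]) (use c A(1) cl[OF f A(2)] in auto)
    finally show ?thesis .
  qed
  ultimately show ?thesis by (auto simp: linear_maps_def)
qed

lemma free_lift_gen:
  assumes "p \<in> S" "b \<in> S \<rightarrow> carrier M"
  shows "free_lift R M b (free_gen R p) = b p"
proof -
  have bp: "b p \<in> carrier M" using assms by blast
  \<comment> \<open>Summing over \<open>{p}\<close> instead of the support also covers a ring with 1
    = 0, where the support of the generator is empty.\<close>
  have "free_lift R M b (free_gen R p) = (\<Oplus>\<^bsub>M\<^esub>q\<in>{p}. free_gen R p q \<odot>\<^bsub>M\<^esub> b q)"
    by (rule free_lift_superset[OF R.free_gen_closed[OF assms(1)] assms(2)])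
      (use assms(1) in \<open>auto simp: free_gen_def\<close>)
  also have "\<dots> = b p" using bp by (simp add: free_gen_def)
  finally show ?thesis .
qed

end

text \<open>Induction on a finite set containing the support, not on the support itself: overwriting
  the value at p by zero leaves a function supported in the smaller set, and the part removed is a
  multiple of the generator at p.\<close>

lemma (in cring) free_module_span:
  assumes Z: "submodule Z R (free_module R S)" and gen: "\<And>p. p \<in> S \<Longrightarrow> free_gen R p \<in> Z"
    and f: "f \<in> carrier (free_module R S)"
  shows "f \<in> Z"
proof -
  let ?F = "free_module R S"
  interpret F: module R ?F by (rule free_module_module)
  have "finite A \<Longrightarrow> f \<in> carrier ?F \<Longrightarrow> {p. f p \<noteq> \<zero>} \<subseteq> A \<Longrightarrow> f \<in> Z" for A f
  proof (induction A arbitrary: f rule: finite_induct)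
    case empty
    then have "f = \<zero>\<^bsub>?F\<^esub>" by (auto simp: free_module_def)
    then show ?case using subgroup.one_closed[OF submodule.axioms(1)[OF Z]] by simp
  next
    case (insert p A)
    show ?case
    proof (cases "p \<in> S")
      case True
      let ?g = "f(p := \<zero>)"
      have "{q. ?g q \<noteq> \<zero>} \<subseteq> {q. f q \<noteq> \<zero>}" by auto
      then have "finite {q. ?g q \<noteq> \<zero>}"
        by (rule finite_subset[OF _ free_module_memD(3)[OF insert.prems(1)]])
      then have g: "?g \<in> carrier ?F"
        using insert.prems(1) by (simp add: free_module_def)
      then have gZ: "?g \<in> Z" by (rule insert.IH) (use insert.prems(2) in auto)
      have pZ: "f p \<odot>\<^bsub>?F\<^esub> free_gen R p \<in> Z"
        by (rule F.submoduleE(4)[OF Z free_module_memD(1)[OF insert.prems(1)] gen[OF True]])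
      have eq: "f = ?g \<oplus>\<^bsub>?F\<^esub> f p \<odot>\<^bsub>?F\<^esub> free_gen R p"
        using free_module_memD(1)[OF insert.prems(1)]
        by (auto simp: free_module_def free_gen_def fun_eq_iff)
      show ?thesis by (subst eq) (rule F.submoduleE(5)[OF Z gZ pZ])
    next
      case False
      then have "f p = \<zero>" using free_module_memD(2)[OF insert.prems(1)] by simp
      then show ?thesis by (intro insert.IH[OF insert.prems(1)]) (use insert.prems(2) in auto)
    qed
  qed
  then show ?thesis using f free_module_memD(3)[OF f] by blast
qed

section \<open>Linear and bilinear maps\<close>

lemma linear_mapsI:
  assumes "\<And>v. v \<in> carrier V \<Longrightarrow> f v \<in> carrier W"
    and "\<And>u v. u \<in> carrier V \<Longrightarrow> v \<in> carrier V \<Longrightarrow> f (u \<oplus>\<^bsub>V\<^esub> v) = f u \<oplus>\<^bsub>W\<^esub> f v"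
    and "\<And>c v. c \<in> carrier K \<Longrightarrow> v \<in> carrier V \<Longrightarrow> f (c \<odot>\<^bsub>V\<^esub> v) = c \<odot>\<^bsub>W\<^esub> f v"
  shows "f \<in> linear_maps K V W"
  using assms by (simp add: linear_maps_def Pi_iff)

lemma linear_mapsD:
  assumes "f \<in> linear_maps K V W"
  shows "v \<in> carrier V \<Longrightarrow> f v \<in> carrier W"
    and "u \<in> carrier V \<Longrightarrow> v \<in> carrier V \<Longrightarrow> f (u \<oplus>\<^bsub>V\<^esub> v) = f u \<oplus>\<^bsub>W\<^esub> f v"
    and "c \<in> carrier K \<Longrightarrow> v \<in> carrier V \<Longrightarrow> f (c \<odot>\<^bsub>V\<^esub> v) = c \<odot>\<^bsub>W\<^esub> f v"
  using assms by (auto simp: linear_maps_def)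

lemma linear_maps_id: "(\<lambda>x. x) \<in> linear_maps K V V"
  by (rule linear_mapsI) auto

lemma linear_maps_comp:
  assumes "f \<in> linear_maps K V W" "g \<in> linear_maps K U V"
  shows "(\<lambda>x. f (g x)) \<in> linear_maps K U W"
  using linear_mapsD[OF assms(1)] linear_mapsD[OF assms(2)] by (intro linear_mapsI) simp_all

lemma bilinear_mapsI:
  assumes "\<And>v. v \<in> carrier V \<Longrightarrow> (\<lambda>w. B v w) \<in> linear_maps K W U"
    and "\<And>w. w \<in> carrier W \<Longrightarrow> (\<lambda>v. B v w) \<in> linear_maps K V U"
  shows "(\<lambda>v w. B v w) \<in> bilinear_maps K V W U"
  using assms by (simp add: bilinear_maps_def)

lemma bilinear_mapsD:
  assumes "B \<in> bilinear_maps K V W U"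
  shows "v \<in> carrier V \<Longrightarrow> B v \<in> linear_maps K W U"
    and "w \<in> carrier W \<Longrightarrow> (\<lambda>v. B v w) \<in> linear_maps K V U"
    and "v \<in> carrier V \<Longrightarrow> w \<in> carrier W \<Longrightarrow> B v w \<in> carrier U"
  using assms linear_mapsD(1) by (fastforce simp: bilinear_maps_def)+

lemma bilinear_maps_left:
  assumes "B \<in> bilinear_maps K V W U" "g \<in> linear_maps K X V" "w \<in> carrier W"
  shows "(\<lambda>x. B (g x) w) \<in> linear_maps K X U"
  using linear_maps_comp[OF bilinear_mapsD(2)[OF assms(1,3)] assms(2)] .

lemma bilinear_maps_right:
  assumes "B \<in> bilinear_maps K V W U" "g \<in> linear_maps K X W" "v \<in> carrier V"
  shows "(\<lambda>x. B v (g x)) \<in> linear_maps K X U"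
  using linear_maps_comp[OF bilinear_mapsD(1)[OF assms(1,3)] assms(2)] .

lemma linear_maps_zero:
  assumes "f \<in> linear_maps K V W" "module K V" "module K W"
  shows "f \<zero>\<^bsub>V\<^esub> = \<zero>\<^bsub>W\<^esub>"
proof -
  interpret V: module K V by fact
  interpret W: module K W by fact
  show ?thesis
    using linear_mapsD(3)[OF assms(1) V.R.zero_closed V.M.zero_closed]
      linear_mapsD(1)[OF assms(1) V.M.zero_closed] by simp
qed

text \<open>\<open>linear_maps\<close> records only sums and scalar multiples, so negatives are
  reached through multiplication by minus one.\<close>

lemma linear_maps_minus:
  assumes f: "f \<in> linear_maps K V W" and "module K V" "module K W"
    and u: "u \<in> carrier V" and v: "v \<in> carrier V"
  shows "f (u \<ominus>\<^bsub>V\<^esub> v) = f u \<ominus>\<^bsub>W\<^esub> f v"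
proof -
  interpret V: module K V by fact
  interpret W: module K W by fact
  let ?c = "\<ominus>\<^bsub>K\<^esub> \<one>\<^bsub>K\<^esub>"
  have c: "?c \<in> carrier K" by simp
  have "\<ominus>\<^bsub>V\<^esub> v = ?c \<odot>\<^bsub>V\<^esub> v" using v by (simp add: V.smult_l_minus)
  moreover have "\<ominus>\<^bsub>W\<^esub> f v = ?c \<odot>\<^bsub>W\<^esub> f v"
    using linear_mapsD(1)[OF f v] by (simp add: W.smult_l_minus)
  ultimately show ?thesis
    using linear_mapsD(2)[OF f u, of "?c \<odot>\<^bsub>V\<^esub> v"] linear_mapsD(3)[OF f c v] c v
    by (simp add: a_minus_def)
qed

lemma linear_maps_kernel:
  assumes f: "f \<in> linear_maps K V W" and V: "module K V" and W: "module K W"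
  shows "submodule {v \<in> carrier V. f v = \<zero>\<^bsub>W\<^esub>} K V"
proof -
  interpret V: module K V by fact
  interpret W: module K W by fact
  have "f (\<ominus>\<^bsub>V\<^esub> v) = \<zero>\<^bsub>W\<^esub>" if "v \<in> carrier V" "f v = \<zero>\<^bsub>W\<^esub>" for v
    using linear_maps_minus[OF f V W V.M.zero_closed that(1)] that linear_maps_zero[OF assms]
    by (simp add: a_minus_def)
  then show ?thesis
    by (intro V.submoduleI) (auto simp: linear_maps_zero[OF assms] linear_mapsD[OF f])
qed

text \<open>Serves two purposes: extending an equality from generators of a tensor product
  (\<open>tensor_ext\<close>), and showing that the coinvariants form a subspace
  (\<open>V_module\<close>).\<close>

lemma linear_maps_equalizer:
  assumes f: "f \<in> linear_maps K V W" and g: "g \<in> linear_maps K V W"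
    and V: "module K V" and W: "module K W"
  shows "submodule {v \<in> carrier V. f v = g v} K V"
proof -
  interpret V: module K V by fact
  interpret W: module K W by fact
  have "f (\<ominus>\<^bsub>V\<^esub> v) = g (\<ominus>\<^bsub>V\<^esub> v)" if "v \<in> carrier V" "f v = g v" for v
    using linear_maps_minus[OF f V W V.M.zero_closed that(1)]
      linear_maps_minus[OF g V W V.M.zero_closed that(1)] that
      linear_maps_zero[OF f V W] linear_maps_zero[OF g V W]
    by (simp add: a_minus_def)
  then show ?thesis
    by (intro V.submoduleI)
      (auto simp: linear_maps_zero[OF f V W] linear_maps_zero[OF g V W] linear_mapsD[OF f] linear_mapsD[OF g])
qed

section \<open>The universal property of the tensor product\<close>

context
  fixes K :: "('k, 'r) ring_scheme" and V :: "('k, 'v, 'x) module_scheme"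
    and W :: "('k, 'w, 'y) module_scheme"
  assumes V: "module K V" and W: "module K W"
begin

interpretation V: module K V by (rule V)
interpretation W: module K W by (rule W)

private abbreviation (input) "F \<equiv> free_module K (carrier V \<times> carrier W)"
private abbreviation (input) "N \<equiv> tensor_relations K V W"
private abbreviation (input) "e v w \<equiv> free_gen K (v, w)"

interpretation F: module K F by (rule V.R.free_module_module)

lemma free_gen_pair_closed: "v \<in> carrier V \<Longrightarrow> w \<in> carrier W \<Longrightarrow> e v w \<in> carrier F"
  by (rule V.R.free_gen_closed) simp

lemma tensor_relations_submodule: "submodule N K F"
  unfolding tensor_relations_def Let_def
  by (rule F.generated_submodule_submodule) (auto intro!: F.M.minus_closed free_gen_pair_closed)

lemma tensor_relations_mem:
  "u \<in> carrier V \<Longrightarrow> v \<in> carrier V \<Longrightarrow> w \<in> carrier W \<Longrightarrow>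
    e (u \<oplus>\<^bsub>V\<^esub> v) w \<ominus>\<^bsub>F\<^esub> (e u w \<oplus>\<^bsub>F\<^esub> e v w) \<in> N"
  "v \<in> carrier V \<Longrightarrow> w \<in> carrier W \<Longrightarrow> z \<in> carrier W \<Longrightarrow>
    e v (w \<oplus>\<^bsub>W\<^esub> z) \<ominus>\<^bsub>F\<^esub> (e v w \<oplus>\<^bsub>F\<^esub> e v z) \<in> N"
  "c \<in> carrier K \<Longrightarrow> v \<in> carrier V \<Longrightarrow> w \<in> carrier W \<Longrightarrow>
    e (c \<odot>\<^bsub>V\<^esub> v) w \<ominus>\<^bsub>F\<^esub> (c \<odot>\<^bsub>F\<^esub> e v w) \<in> N"
  "c \<in> carrier K \<Longrightarrow> v \<in> carrier V \<Longrightarrow> w \<in> carrier W \<Longrightarrow>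
    e v (c \<odot>\<^bsub>W\<^esub> w) \<ominus>\<^bsub>F\<^esub> (c \<odot>\<^bsub>F\<^esub> e v w) \<in> N"
  unfolding tensor_relations_def Let_def
  by (rule subsetD[OF generated_submodule_incl], blast)+

lemma tensor_relations_least:
  assumes "submodule N' K F"
    and "\<And>u v w. u \<in> carrier V \<Longrightarrow> v \<in> carrier V \<Longrightarrow> w \<in> carrier W \<Longrightarrow>
      e (u \<oplus>\<^bsub>V\<^esub> v) w \<ominus>\<^bsub>F\<^esub> (e u w \<oplus>\<^bsub>F\<^esub> e v w) \<in> N'"
    and "\<And>v w z. v \<in> carrier V \<Longrightarrow> w \<in> carrier W \<Longrightarrow> z \<in> carrier W \<Longrightarrow>
      e v (w \<oplus>\<^bsub>W\<^esub> z) \<ominus>\<^bsub>F\<^esub> (e v w \<oplus>\<^bsub>F\<^esub> e v z) \<in> N'"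
    and "\<And>c v w. c \<in> carrier K \<Longrightarrow> v \<in> carrier V \<Longrightarrow> w \<in> carrier W \<Longrightarrow>
      e (c \<odot>\<^bsub>V\<^esub> v) w \<ominus>\<^bsub>F\<^esub> (c \<odot>\<^bsub>F\<^esub> e v w) \<in> N'"
    and "\<And>c v w. c \<in> carrier K \<Longrightarrow> v \<in> carrier V \<Longrightarrow> w \<in> carrier W \<Longrightarrow>
      e v (c \<odot>\<^bsub>W\<^esub> w) \<ominus>\<^bsub>F\<^esub> (c \<odot>\<^bsub>F\<^esub> e v w) \<in> N'"
  shows "N \<subseteq> N'"
  unfolding tensor_relations_def Let_def
proof (rule generated_submodule_least[OF assms(1)])
qed (safe, simp_all only: assms)

lemma tensor_module: "module K (tensor K V W)"
  unfolding tensor_def by (rule F.quotient_module_module[OF tensor_relations_submodule])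

lemma tensor_carrier: "carrier (tensor K V W) = (\<lambda>f. N +>\<^bsub>F\<^esub> f) ` carrier F"
  unfolding tensor_def by (rule F.quotient_carrier[OF tensor_relations_submodule])

lemma pure_tensor_closed:
  "v \<in> carrier V \<Longrightarrow> w \<in> carrier W \<Longrightarrow> pure_tensor K V W v w \<in> carrier (tensor K V W)"
  unfolding tensor_carrier pure_tensor_def using free_gen_pair_closed by blast

lemma coset_linear: "(\<lambda>f. N +>\<^bsub>F\<^esub> f) \<in> linear_maps K F (tensor K V W)"
  by (rule linear_mapsI, use tensor_carrier in blast)
    (simp_all add: tensor_def F.quotient_add[OF tensor_relations_submodule]
      F.quotient_smult[OF tensor_relations_submodule])

text \<open>The four families of relations are exactly the two additivity and two homogeneity laws,
  read modulo N.\<close>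

lemma pure_tensor_bilinear: "pure_tensor K V W \<in> bilinear_maps K V W (tensor K V W)"
proof -
  note eq = F.coset_eq_iff[OF tensor_relations_submodule, THEN iffD2]
  note cl = free_gen_pair_closed
  show ?thesis
    by (rule bilinear_mapsI; rule linear_mapsI, simp add: pure_tensor_closed)
      (unfold pure_tensor_def linear_mapsD(2,3)[OF coset_linear, symmetric],
       simp_all add: linear_mapsD(2,3)[OF coset_linear, symmetric] cl tensor_relations_mem eq)
qed

context
  fixes U :: "('k, 'u, 'z) module_scheme" and B
  assumes U: "module K U" and B: "B \<in> bilinear_maps K V W U"
begin

interpretation U: module K U by (rule U)

text \<open>Well-definedness of the induced map. Bilinearity of B makes \<open>free_lift\<close>
  vanish on each generating relation, hence on all of N, so the representative picked by
  \<open>SOME\<close> has the same value as f.\<close>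

lemma tensor_lift_coset:
  assumes f: "f \<in> carrier F"
  shows "tensor_lift K V W U B (N +>\<^bsub>F\<^esub> f) = free_lift K U (\<lambda>p. B (fst p) (snd p)) f"
proof -
  let ?b = "\<lambda>p. B (fst p) (snd p)"
  let ?L = "free_lift K U ?b"
  have b: "?b \<in> carrier V \<times> carrier W \<rightarrow> carrier U" using bilinear_mapsD(3)[OF B] by auto
  have L: "?L \<in> linear_maps K F U" by (rule U.free_lift_linear[OF b])
  have Le: "?L (e v w) = B v w" if "v \<in> carrier V" "w \<in> carrier W" for v w
    using U.free_lift_gen[OF _ b] that by simp
  note cl = free_gen_pair_closed
  note simps = linear_maps_minus[OF L F.module_axioms U] linear_mapsD[OF L] cl Le
    bilinear_mapsD(3)[OF B] linear_mapsD(2,3)[OF bilinear_mapsD(1)[OF B]]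
    linear_mapsD(2,3)[OF bilinear_mapsD(2)[OF B]] U.M.r_neg
  have "N \<subseteq> {f \<in> carrier F. ?L f = \<zero>\<^bsub>U\<^esub>}"
    by (rule tensor_relations_least[OF linear_maps_kernel[OF L F.module_axioms U]])
      (simp_all add: simps, simp_all add: a_minus_def simps)
  then have ker: "n \<in> carrier F \<and> ?L n = \<zero>\<^bsub>U\<^esub>" if "n \<in> N" for n using that by blast
  define g where "g = (SOME g. g \<in> N +>\<^bsub>F\<^esub> f)"
  have "g \<in> N +>\<^bsub>F\<^esub> f"
    unfolding g_def some_in_eq using F.coset_self[OF tensor_relations_submodule f] by blast
  then obtain n where n: "n \<in> N" "g = n \<oplus>\<^bsub>F\<^esub> f" using F.coset_memD[OF tensor_relations_submodule f] by blast
  have "?L g = ?L f" using ker[OF n(1)] f n(2) linear_mapsD(1,2)[OF L] by simp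
  then show ?thesis unfolding tensor_lift_def Let_def g_def[symmetric] free_lift_def .
qed

lemma tensor_lift_pure:
  assumes "v \<in> carrier V" "w \<in> carrier W"
  shows "tensor_lift K V W U B (pure_tensor K V W v w) = B v w"
proof -
  have b: "(\<lambda>p. B (fst p) (snd p)) \<in> carrier V \<times> carrier W \<rightarrow> carrier U"
    using bilinear_mapsD(3)[OF B] by auto
  show ?thesis
    unfolding pure_tensor_def
    using tensor_lift_coset[OF free_gen_pair_closed[OF assms]] U.free_lift_gen[OF _ b] assms by simp
qed

lemma tensor_lift_linear: "tensor_lift K V W U B \<in> linear_maps K (tensor K V W) U"
proof -
  let ?L = "free_lift K U (\<lambda>p. B (fst p) (snd p))"
  have b: "(\<lambda>p. B (fst p) (snd p)) \<in> carrier V \<times> carrier W \<rightarrow> carrier U"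
    using bilinear_mapsD(3)[OF B] by auto
  have L: "?L \<in> linear_maps K F U" by (rule U.free_lift_linear[OF b])
  show ?thesis
    by (rule linear_mapsI)
      (auto simp: tensor_carrier tensor_lift_coset linear_mapsD[OF L]
        linear_mapsD(2,3)[OF coset_linear, symmetric])
qed

end

text \<open>Pulled back to the free module, the place where f and g agree is an equalizer submodule
  that contains every generator, hence everything. This is what allows an identity of Sweedler sums
  to be checked on pure tensors only.\<close>

lemma tensor_ext:
  assumes U: "module K U"
    and f: "f \<in> linear_maps K (tensor K V W) U" and g: "g \<in> linear_maps K (tensor K V W) U"
    and eq: "\<And>v w. v \<in> carrier V \<Longrightarrow> w \<in> carrier W \<Longrightarrow>
      f (pure_tensor K V W v w) = g (pure_tensor K V W v w)"
    and x: "x \<in> carrier (tensor K V W)"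
  shows "f x = g x"
proof -
  obtain h where h: "h \<in> carrier F" "x = N +>\<^bsub>F\<^esub> h" using x tensor_carrier by blast
  have "h \<in> {h \<in> carrier F. f (N +>\<^bsub>F\<^esub> h) = g (N +>\<^bsub>F\<^esub> h)}"
  proof (rule V.R.free_module_span[OF linear_maps_equalizer[OF _ _ F.module_axioms U] _ h(1)])
    show "(\<lambda>h. f (N +>\<^bsub>F\<^esub> h)) \<in> linear_maps K F U" by (rule linear_maps_comp[OF f coset_linear])
    show "(\<lambda>h. g (N +>\<^bsub>F\<^esub> h)) \<in> linear_maps K F U" by (rule linear_maps_comp[OF g coset_linear])
    fix p assume "p \<in> carrier V \<times> carrier W"
    then show "free_gen K p \<in> {h \<in> carrier F. f (N +>\<^bsub>F\<^esub> h) = g (N +>\<^bsub>F\<^esub> h)}"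
      using eq free_gen_pair_closed by (auto simp: pure_tensor_def)
  qed
  then show ?thesis using h by simp
qed

text \<open>Not an instance of \<open>tensor_ext\<close>, since neither B nor B' is assumed
  bilinear. Both sides evaluate the same \<open>SOME\<close> representative g, whose support
  consists of pairs from the two carriers, so the two finite sums agree term by term.\<close>

lemma tensor_lift_cong:
  assumes B: "\<And>v w. v \<in> carrier V \<Longrightarrow> w \<in> carrier W \<Longrightarrow> B v w = B' v w"
    and cl: "\<And>v w. v \<in> carrier V \<Longrightarrow> w \<in> carrier W \<Longrightarrow> B' v w \<in> carrier U"
    and U: "module K U" and x: "x \<in> carrier (tensor K V W)"
  shows "tensor_lift K V W U B x = tensor_lift K V W U B' x"
proof -
  interpret U: module K U by (rule U)
  obtain h where h: "h \<in> carrier F" "x = N +>\<^bsub>F\<^esub> h" using x tensor_carrier by blast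
  define g where "g = (SOME g. g \<in> x)"
  have "g \<in> N +>\<^bsub>F\<^esub> h"
    unfolding g_def h(2) some_in_eq
    using F.coset_self[OF tensor_relations_submodule h(1)] by blast
  then have "g \<in> carrier F"
    using F.M.a_r_coset_subset_G[OF F.submoduleE(1)[OF tensor_relations_submodule] h(1)] by blast
  note g = V.R.free_module_memD[OF this]
  have mem: "fst p \<in> carrier V" "snd p \<in> carrier W" if "p \<in> {p. g p \<noteq> \<zero>\<^bsub>K\<^esub>}" for p
    using subsetD[OF g(4) that] by auto
  show ?thesis
    unfolding tensor_lift_def Let_def g_def[symmetric]
  proof (rule U.M.finsum_cong'[OF refl])
    show "(\<lambda>p. g p \<odot>\<^bsub>U\<^esub> B' (fst p) (snd p)) \<in> {p. g p \<noteq> \<zero>\<^bsub>K\<^esub>} \<rightarrow> carrier U"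
      using g(1) cl[OF mem] by (intro Pi_I U.smult_closed)
  qed (simp add: B[OF mem])
qed

end

section \<open>Linearity rules and Sweedler sums\<close>

text \<open>Introduction rules that follow the outermost shape of a summand, so that
  \<open>fast\<close> reduces (bi)linearity of a nested Sweedler sum to that of the structure maps.
  Maps enter in composed form, with an arbitrary linear map inside, because a general composition
  rule would leave the outer map to be guessed.\<close>

named_theorems linear_intros

lemmas [linear_intros] = linear_maps_id tensor_module bilinear_mapsI pure_tensor_closed
  bilinear_maps_left[OF pure_tensor_bilinear] bilinear_maps_right[OF pure_tensor_bilinear]

lemma linear_maps_add:
  assumes "f \<in> linear_maps K V W" "g \<in> linear_maps K V W" "module K W"
  shows "(\<lambda>v. f v \<oplus>\<^bsub>W\<^esub> g v) \<in> linear_maps K V W"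
proof -
  interpret W: module K W by fact
  show ?thesis
    using linear_mapsD[OF assms(1)] linear_mapsD[OF assms(2)]
    by (intro linear_mapsI) (simp_all add: W.M.a_ac W.smult_r_distr)
qed

lemma linear_maps_smult:
  assumes "f \<in> linear_maps K V W" "c \<in> carrier K" "module K W"
  shows "(\<lambda>v. c \<odot>\<^bsub>W\<^esub> f v) \<in> linear_maps K V W"
proof -
  interpret W: module K W by fact
  have "c \<odot>\<^bsub>W\<^esub> (d \<odot>\<^bsub>W\<^esub> w) = d \<odot>\<^bsub>W\<^esub> (c \<odot>\<^bsub>W\<^esub> w)" if "d \<in> carrier K" "w \<in> carrier W" for d w
    using that assms(2) by (simp add: W.smult_assoc1[symmetric] W.R.m_comm)
  then show ?thesis
    using linear_mapsD[OF assms(1)] assms(2)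
    by (intro linear_mapsI) (simp_all add: W.smult_r_distr)
qed

lemma linear_maps_lift [linear_intros]:
  assumes "module K V" "module K W" "module K U"
    and "B \<in> bilinear_maps K V W U" "g \<in> linear_maps K X (tensor K V W)"
  shows "(\<lambda>x. tensor_lift K V W U B (g x)) \<in> linear_maps K X U"
  by (rule linear_maps_comp[OF tensor_lift_linear[OF assms(1-4)] assms(5)])

lemma tensor_lift_closed [linear_intros]:
  assumes "module K V" "module K W" "module K U"
    and "B \<in> bilinear_maps K V W U" "x \<in> carrier (tensor K V W)"
  shows "tensor_lift K V W U B x \<in> carrier U"
  by (rule linear_mapsD(1)[OF tensor_lift_linear[OF assms(1-4)] assms(5)])

text \<open>Here the parameter sits in the summand, not in the tensor. For pure y the claim is
  \<open>lin\<close>; both sides are linear in y, so \<open>tensor_ext\<close> extends it. Nested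
  sums whose inner summand mentions an outer variable depend on this rule.\<close>

lemma linear_maps_lift_param [linear_intros]:
  assumes V: "module K V" and W: "module K W" and U: "module K U" and X: "module K X"
    and B: "\<And>x. x \<in> carrier X \<Longrightarrow> B x \<in> bilinear_maps K V W U"
    and lin: "\<And>v w. v \<in> carrier V \<Longrightarrow> w \<in> carrier W \<Longrightarrow> (\<lambda>x. B x v w) \<in> linear_maps K X U"
    and y: "y \<in> carrier (tensor K V W)"
  shows "(\<lambda>x. tensor_lift K V W U (B x) y) \<in> linear_maps K X U"
proof -
  interpret U: module K U by (rule U)
  interpret X: module K X by (rule X)
  note L = tensor_lift_linear[OF V W U B]
  note P = tensor_lift_pure[OF V W U B]
  show ?thesis
  proof (rule linear_mapsI)
    fix x assume "x \<in> carrier X"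
    then show "tensor_lift K V W U (B x) y \<in> carrier U" by (rule linear_mapsD(1)[OF L y])
  next
    fix x z assume xz: "x \<in> carrier X" "z \<in> carrier X"
    show "tensor_lift K V W U (B (x \<oplus>\<^bsub>X\<^esub> z)) y =
        tensor_lift K V W U (B x) y \<oplus>\<^bsub>U\<^esub> tensor_lift K V W U (B z) y"
      by (rule tensor_ext[OF V W U L linear_maps_add[OF L L U] _ y])
        (simp_all add: xz P linear_mapsD(2)[OF lin])
  next
    fix c x assume cx: "c \<in> carrier K" "x \<in> carrier X"
    show "tensor_lift K V W U (B (c \<odot>\<^bsub>X\<^esub> x)) y = c \<odot>\<^bsub>U\<^esub> tensor_lift K V W U (B x) y"
      by (rule tensor_ext[OF V W U L linear_maps_smult[OF L _ U] _ y])
        (simp_all add: cx P linear_mapsD(3)[OF lin])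
  qed
qed

text \<open>Both sides are linear in x and take the value f(B(v, w)) on v (x) w. Read backwards, the
  rule pulls a common linear map out of a Sweedler sum.\<close>

lemma linear_map_lift:
  assumes "f \<in> linear_maps K U U'" "B \<in> bilinear_maps K V W U" "x \<in> carrier (tensor K V W)"
    and V: "module K V" and W: "module K W" and U: "module K U" and U': "module K U'"
  shows "f (tensor_lift K V W U B x) = tensor_lift K V W U' (\<lambda>v w. f (B v w)) x"
proof -
  have fB: "(\<lambda>v w. f (B v w)) \<in> bilinear_maps K V W U'"
    by (intro bilinear_mapsI linear_maps_comp[OF assms(1)] bilinear_mapsD[OF assms(2)])
  show ?thesis
    by (rule tensor_ext[OF V W U' linear_maps_comp[OF assms(1) tensor_lift_linear[OF V W U assms(2)]]
          tensor_lift_linear[OF V W U' fB] _ assms(3)])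
      (simp add: tensor_lift_pure[OF V W U assms(2)] tensor_lift_pure[OF V W U' fB])
qed

lemma tensor_map_bilinear:
  assumes "module K V'" "module K W'" "f \<in> linear_maps K V V'" "g \<in> linear_maps K W W'"
  shows "(\<lambda>v w. pure_tensor K V' W' (f v) (g w)) \<in> bilinear_maps K V W (tensor K V' W')"
  by (intro bilinear_mapsI bilinear_maps_left[OF pure_tensor_bilinear]
      bilinear_maps_right[OF pure_tensor_bilinear] linear_mapsD(1)[OF assms(3)]
      linear_mapsD(1)[OF assms(4)] assms)

context
  fixes K V W V' W' f g
  assumes V: "module K V" and W: "module K W" and V': "module K V'" and W': "module K W'"
    and f: "f \<in> linear_maps K V V'" and g: "g \<in> linear_maps K W W'"
begin

lemma tensor_map_linear: "tensor_map K V W V' W' f g \<in> linear_maps K (tensor K V W) (tensor K V' W')"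
  unfolding tensor_map_def
  by (rule tensor_lift_linear[OF V W tensor_module[OF V' W'] tensor_map_bilinear[OF V' W' f g]])

lemma tensor_map_pure:
  "v \<in> carrier V \<Longrightarrow> w \<in> carrier W \<Longrightarrow>
    tensor_map K V W V' W' f g (pure_tensor K V W v w) = pure_tensor K V' W' (f v) (g w)"
  unfolding tensor_map_def
  by (rule tensor_lift_pure[OF V W tensor_module[OF V' W'] tensor_map_bilinear[OF V' W' f g]])

text \<open>The substitution rule for Sweedler sums: \<open>tensor_map\<close> is itself a lift, so
  the outer lift passes inside it and is then evaluated on pure tensors.\<close>

lemma tensor_lift_map:
  assumes U: "module K U" and B: "B \<in> bilinear_maps K V' W' U" and x: "x \<in> carrier (tensor K V W)"
  shows "tensor_lift K V' W' U B (tensor_map K V W V' W' f g x) =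
    tensor_lift K V W U (\<lambda>v w. B (f v) (g w)) x"
  unfolding tensor_map_def
  by (subst linear_map_lift[OF tensor_lift_linear[OF V' W' U B] tensor_map_bilinear[OF V' W' f g] x
        V W tensor_module[OF V' W'] U],
      rule tensor_lift_cong[OF V W _ _ U x])
    (simp_all add: tensor_lift_pure[OF V' W' U B] linear_mapsD(1)[OF f] linear_mapsD(1)[OF g]
      bilinear_mapsD(3)[OF B])

end

context
  fixes K U V W
  assumes U: "module K U" and V: "module K V" and W: "module K W"
begin

lemma assoc_bilinear:
  "(\<lambda>x w. tensor_lift K U V (tensor K U (tensor K V W))
        (\<lambda>u v. pure_tensor K U (tensor K V W) u (pure_tensor K V W v w)) x)
    \<in> bilinear_maps K (tensor K U V) W (tensor K U (tensor K V W))"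
  using U V W by (fast intro: linear_intros)

lemma tensor_assoc_linear:
  "tensor_assoc K U V W \<in> linear_maps K (tensor K (tensor K U V) W) (tensor K U (tensor K V W))"
  unfolding tensor_assoc_def
  by (rule tensor_lift_linear[OF _ _ _ assoc_bilinear]) (intro tensor_module U V W)+

lemma tensor_assoc_pure:
  "x \<in> carrier (tensor K U V) \<Longrightarrow> w \<in> carrier W \<Longrightarrow>
    tensor_assoc K U V W (pure_tensor K (tensor K U V) W x w) =
    tensor_lift K U V (tensor K U (tensor K V W))
      (\<lambda>u v. pure_tensor K U (tensor K V W) u (pure_tensor K V W v w)) x"
  unfolding tensor_assoc_def
  by (rule tensor_lift_pure[OF _ _ _ assoc_bilinear]) (intro tensor_module U V W | assumption)+

end

context
  fixes K A V A' W B U \<mu> \<nu>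
  assumes A: "module K A" and V: "module K V" and A': "module K A'" and W: "module K W"
    and B: "module K B" and U: "module K U"
    and \<mu>: "\<mu> \<in> bilinear_maps K A A' B" and \<nu>: "\<nu> \<in> bilinear_maps K V W U"
begin

private lemmas rules = A V A' W B U bilinear_mapsD(3)[OF \<mu>] bilinear_mapsD(3)[OF \<nu>]
  bilinear_maps_left[OF \<mu>] bilinear_maps_right[OF \<mu>]
  bilinear_maps_left[OF \<nu>] bilinear_maps_right[OF \<nu>]

lemma tensor_prod_inner_bilinear:
  "a \<in> carrier A \<Longrightarrow> v \<in> carrier V \<Longrightarrow>
    (\<lambda>a' w. pure_tensor K B U (\<mu> a a') (\<nu> v w)) \<in> bilinear_maps K A' W (tensor K B U)"
  by (fast intro: linear_intros rules)

lemma tensor_prod_outer_bilinear: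
  "y \<in> carrier (tensor K A' W) \<Longrightarrow>
    (\<lambda>a v. tensor_lift K A' W (tensor K B U)
        (\<lambda>a' w. pure_tensor K B U (\<mu> a a') (\<nu> v w)) y) \<in> bilinear_maps K A V (tensor K B U)"
  by (fast intro: linear_intros rules)

lemma tensor_prod_bilinear:
  "tensor_prod K A V A' W B U \<mu> \<nu> \<in>
    bilinear_maps K (tensor K A V) (tensor K A' W) (tensor K B U)"
  unfolding tensor_prod_def by (fast intro: linear_intros rules)

lemma tensor_prod_pure_left:
  "a \<in> carrier A \<Longrightarrow> v \<in> carrier V \<Longrightarrow> y \<in> carrier (tensor K A' W) \<Longrightarrow>
    tensor_prod K A V A' W B U \<mu> \<nu> (pure_tensor K A V a v) y =
    tensor_lift K A' W (tensor K B U) (\<lambda>a' w. pure_tensor K B U (\<mu> a a') (\<nu> v w)) y"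
  unfolding tensor_prod_def
  by (rule tensor_lift_pure[OF A V tensor_module[OF B U] tensor_prod_outer_bilinear])

lemma tensor_prod_pure:
  "a \<in> carrier A \<Longrightarrow> v \<in> carrier V \<Longrightarrow> a' \<in> carrier A' \<Longrightarrow> w \<in> carrier W \<Longrightarrow>
    tensor_prod K A V A' W B U \<mu> \<nu> (pure_tensor K A V a v) (pure_tensor K A' W a' w) =
    pure_tensor K B U (\<mu> a a') (\<nu> v w)"
  by (simp add: tensor_prod_pure_left pure_tensor_closed A' W
      tensor_lift_pure[OF A' W tensor_module[OF B U] tensor_prod_inner_bilinear])

end

section \<open>Coassociativity\<close>

text \<open>Coassociativity in the form used for computation: a trilinear T induces a linear map on
  H (x) (H (x) M), and applying it to the two sides of \<open>coassoc\<close> yields the two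
  iterated sums. Keeping \<delta> and \<rho> abstract lets it serve both a coaction and the
  comultiplication itself, where M is H.\<close>

lemma coassoc_lift:
  assumes H: "module K H" and M: "module K M" and U: "module K U"
    and \<delta>: "\<delta> \<in> linear_maps K H (tensor K H H)" and \<rho>: "\<rho> \<in> linear_maps K M (tensor K H M)"
    and coassoc: "tensor_assoc K H H M (tensor_map K H M (tensor K H H) M \<delta> (\<lambda>x. x) x) =
      tensor_map K H M H (tensor K H M) (\<lambda>x. x) \<rho> x"
    and x: "x \<in> carrier (tensor K H M)"
    and T: "\<And>a. a \<in> carrier H \<Longrightarrow> T a \<in> bilinear_maps K H M U"
      "\<And>b n. b \<in> carrier H \<Longrightarrow> n \<in> carrier M \<Longrightarrow> (\<lambda>a. T a b n) \<in> linear_maps K H U"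
  shows "tensor_lift K H M U (\<lambda>a n. tensor_lift K H H U (\<lambda>b c. T b c n) (\<delta> a)) x =
    tensor_lift K H M U (\<lambda>a n. tensor_lift K H M U (T a) (\<rho> n)) x"
proof -
  let ?HH = "tensor K H H" and ?HM = "tensor K H M"
  have T1: "(\<lambda>c. T b c n) \<in> linear_maps K H U" if "b \<in> carrier H" "n \<in> carrier M" for b n
    using bilinear_mapsD(2)[OF T(1)] that by blast
  have T2: "T b c \<in> linear_maps K M U" if "b \<in> carrier H" "c \<in> carrier H" for b c
    using bilinear_mapsD(1)[OF T(1)] that by blast
  note rules = linear_intros H M U linear_maps_comp[OF \<delta>] linear_mapsD(1)[OF \<delta>]
    linear_maps_comp[OF \<rho>] linear_mapsD(1)[OF \<rho>] T T1 T2
  note HH = tensor_module[OF H H] and HM = tensor_module[OF H M]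
  have QB: "(\<lambda>a y. tensor_lift K H M U (T a) y) \<in> bilinear_maps K H ?HM U"
    by (fast intro: rules)
  \<comment> \<open>The linear map induced by T: it sends a (x) (b (x) n) to T a b n.\<close>
  define Q where "Q = tensor_lift K H ?HM U (\<lambda>a y. tensor_lift K H M U (T a) y)"
  have Q: "Q \<in> linear_maps K (tensor K H ?HM) U"
    unfolding Q_def by (rule tensor_lift_linear[OF H HM U QB])
  have Qp: "Q (pure_tensor K H ?HM a y) = tensor_lift K H M U (T a) y"
    if "a \<in> carrier H" "y \<in> carrier ?HM" for a y
    unfolding Q_def by (rule tensor_lift_pure[OF H HM U QB that])
  have LB: "(\<lambda>a n. tensor_lift K H H U (\<lambda>b c. T b c n) (\<delta> a)) \<in> bilinear_maps K H M U"
    by (fast intro: rules)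
  have RB: "(\<lambda>a n. tensor_lift K H M U (T a) (\<rho> n)) \<in> bilinear_maps K H M U"
    by (fast intro: rules)
  have "Q (tensor_assoc K H H M (tensor_map K H M ?HH M \<delta> (\<lambda>x. x) x)) =
      tensor_lift K H M U (\<lambda>a n. tensor_lift K H H U (\<lambda>b c. T b c n) (\<delta> a)) x"
  proof (rule tensor_ext[OF H M U _ tensor_lift_linear[OF H M U LB] _ x])
    show "(\<lambda>x. Q (tensor_assoc K H H M (tensor_map K H M ?HH M \<delta> (\<lambda>x. x) x))) \<in> linear_maps K ?HM U"
      by (intro linear_maps_comp[OF Q] linear_maps_comp[OF tensor_assoc_linear[OF H H M]]
          tensor_map_linear[OF H M HH M \<delta>] linear_maps_id)
    fix a n assume an: "a \<in> carrier H" "n \<in> carrier M"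
    have cl: "(\<lambda>b c. pure_tensor K H ?HM b (pure_tensor K H M c n)) \<in> bilinear_maps K H H (tensor K H ?HM)"
      using an by (fast intro: rules)
    have "Q (tensor_assoc K H H M (tensor_map K H M ?HH M \<delta> (\<lambda>x. x) (pure_tensor K H M a n))) =
      Q (tensor_lift K H H (tensor K H ?HM) (\<lambda>b c. pure_tensor K H ?HM b (pure_tensor K H M c n)) (\<delta> a))"
      using an by (simp add: tensor_map_pure[OF H M HH M \<delta> linear_maps_id]
          tensor_assoc_pure[OF H H M] linear_mapsD(1)[OF \<delta>])
    also have "\<dots> = tensor_lift K H H U (\<lambda>b c. Q (pure_tensor K H ?HM b (pure_tensor K H M c n))) (\<delta> a)"
      by (rule linear_map_lift[OF Q cl linear_mapsD(1)[OF \<delta> an(1)] H H tensor_module[OF H HM] U])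
    also have "\<dots> = tensor_lift K H H U (\<lambda>b c. T b c n) (\<delta> a)"
    proof (rule tensor_lift_cong[OF H H _ _ U linear_mapsD(1)[OF \<delta> an(1)]])
      fix b c assume bc: "b \<in> carrier H" "c \<in> carrier H"
      show "T b c n \<in> carrier U" by (rule bilinear_mapsD(3)[OF T(1)[OF bc(1)] bc(2) an(2)])
      show "Q (pure_tensor K H ?HM b (pure_tensor K H M c n)) = T b c n"
        using bc an by (simp add: Qp pure_tensor_closed[OF H M] tensor_lift_pure[OF H M U T(1)])
    qed
    also have "\<dots> = tensor_lift K H M U (\<lambda>a n. tensor_lift K H H U (\<lambda>b c. T b c n) (\<delta> a))
        (pure_tensor K H M a n)"
      by (rule tensor_lift_pure[OF H M U LB an, symmetric])
    finally show "Q (tensor_assoc K H H M (tensor_map K H M ?HH M \<delta> (\<lambda>x. x) (pure_tensor K H M a n))) =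
      tensor_lift K H M U (\<lambda>a n. tensor_lift K H H U (\<lambda>b c. T b c n) (\<delta> a)) (pure_tensor K H M a n)" .
  qed
  moreover have "Q (tensor_map K H M H ?HM (\<lambda>x. x) \<rho> x) =
      tensor_lift K H M U (\<lambda>a n. tensor_lift K H M U (T a) (\<rho> n)) x"
    by (rule tensor_ext[OF H M U linear_maps_comp[OF Q tensor_map_linear[OF H M H HM linear_maps_id \<rho>]]
          tensor_lift_linear[OF H M U RB] _ x])
      (simp add: tensor_map_pure[OF H M H HM linear_maps_id \<rho>] tensor_lift_pure[OF H M U RB] Qp
        linear_mapsD(1)[OF \<rho>])
  ultimately show ?thesis using coassoc by simp
qed

section \<open>Hopf algebras\<close>

locale hopf_alg_over =
  fixes K :: "('k, 'r) ring_scheme" and H :: "('k, 'h, 'x) hopf_alg_scheme"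
  assumes hopf: "hopf_algebra K H"
begin

lemma H_module [linear_intros]: "module K H"
  and H_ring: "ring H"
  and H_coalgebra: "coalgebra K H"
  and comult_linear: "comult H \<in> linear_maps K H (tensor K H H)"
  and antipode_linear: "antipode H \<in> linear_maps K H H"
  using hopf by (simp_all add: hopf_algebra_def bialgebra_def assoc_algebra_def coalgebra_def)

sublocale H: ring H by (rule H_ring)

lemma mult_bilinear: "mult H \<in> bilinear_maps K H H H"
proof -
  have "(c \<odot>\<^bsub>H\<^esub> x) \<otimes>\<^bsub>H\<^esub> y = c \<odot>\<^bsub>H\<^esub> (x \<otimes>\<^bsub>H\<^esub> y)" "x \<otimes>\<^bsub>H\<^esub> (c \<odot>\<^bsub>H\<^esub> y) = c \<odot>\<^bsub>H\<^esub> (x \<otimes>\<^bsub>H\<^esub> y)"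
    if "c \<in> carrier K" "x \<in> carrier H" "y \<in> carrier H" for c x y
    using hopf that by (simp_all add: hopf_algebra_def bialgebra_def assoc_algebra_def)
  then show ?thesis
    by (intro bilinear_mapsI linear_mapsI) (simp_all add: H.l_distr H.r_distr)
qed

lemma comult_mult:
  "g \<in> carrier H \<Longrightarrow> h \<in> carrier H \<Longrightarrow> comult H (g \<otimes>\<^bsub>H\<^esub> h) =
    tensor_prod K H H H H H H (mult H) (mult H) (comult H g) (comult H h)"
  and comult_one: "comult H \<one>\<^bsub>H\<^esub> = pure_tensor K H H \<one>\<^bsub>H\<^esub> \<one>\<^bsub>H\<^esub>"
  using hopf by (simp_all add: hopf_algebra_def bialgebra_def tensor_algebra_def ring_hom_def)

lemma counit_closed: "h \<in> carrier H \<Longrightarrow> counit H h \<in> carrier K"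
  using H_coalgebra by (auto simp: coalgebra_def)

text \<open>K is a ring record, not a module over itself, so the counit cannot be placed in
  \<open>linear_maps\<close>. Its linearity is used through the pairing of h and u with the vector
  counit(h) u.\<close>

lemma counit_smult_bilinear:
  assumes U: "module K U"
  shows "(\<lambda>h u. counit H h \<odot>\<^bsub>U\<^esub> u) \<in> bilinear_maps K H U U"
proof -
  interpret U: module K U by (rule U)
  show ?thesis
    using H_coalgebra
    by (intro bilinear_mapsI linear_maps_smult[OF linear_maps_id _ U] linear_mapsI)
      (simp_all add: coalgebra_def counit_closed U.smult_l_distr U.smult_assoc1)
qed

lemma counit_smult_closed [linear_intros]:
  "module K U \<Longrightarrow> h \<in> carrier H \<Longrightarrow> u \<in> carrier U \<Longrightarrow> counit H h \<odot>\<^bsub>U\<^esub> u \<in> carrier U"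
  by (rule bilinear_mapsD(3)[OF counit_smult_bilinear])

lemmas [linear_intros] = linear_maps_comp[OF comult_linear] linear_mapsD(1)[OF comult_linear]
  linear_maps_comp[OF antipode_linear] linear_mapsD(1)[OF antipode_linear]
  bilinear_maps_left[OF mult_bilinear] bilinear_maps_right[OF mult_bilinear]
  bilinear_mapsD(3)[OF mult_bilinear] H.one_closed
  bilinear_maps_left[OF counit_smult_bilinear] bilinear_maps_right[OF counit_smult_bilinear]

lemma comult_coassoc:
  "h \<in> carrier H \<Longrightarrow> tensor_assoc K H H H
     (tensor_map K H H (tensor K H H) H (comult H) (\<lambda>x. x) (comult H h)) =
   tensor_map K H H H (tensor K H H) (\<lambda>x. x) (comult H) (comult H h)"
  and counit_left: "h \<in> carrier H \<Longrightarrow>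
    tensor_lift K H H H (\<lambda>a b. counit H a \<odot>\<^bsub>H\<^esub> b) (comult H h) = h"
  and counit_right: "h \<in> carrier H \<Longrightarrow>
    tensor_lift K H H H (\<lambda>a b. counit H b \<odot>\<^bsub>H\<^esub> a) (comult H h) = h"
  using H_coalgebra by (simp_all add: coalgebra_def)

lemma antipode_left: "h \<in> carrier H \<Longrightarrow>
    tensor_lift K H H H (\<lambda>a b. antipode H a \<otimes>\<^bsub>H\<^esub> b) (comult H h) = counit H h \<odot>\<^bsub>H\<^esub> \<one>\<^bsub>H\<^esub>"
  and antipode_right: "h \<in> carrier H \<Longrightarrow>
    tensor_lift K H H H (\<lambda>a b. a \<otimes>\<^bsub>H\<^esub> antipode H b) (comult H h) = counit H h \<odot>\<^bsub>H\<^esub> \<one>\<^bsub>H\<^esub>"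
  using hopf by (simp_all add: hopf_algebra_def)

lemma left_moduleD:
  assumes "left_module K H N"
  shows "module K N" and "act N \<in> bilinear_maps K H N N"
    and "g \<in> carrier H \<Longrightarrow> h \<in> carrier H \<Longrightarrow> n \<in> carrier N \<Longrightarrow>
      act N (g \<otimes>\<^bsub>H\<^esub> h) n = act N g (act N h n)"
    and "n \<in> carrier N \<Longrightarrow> act N \<one>\<^bsub>H\<^esub> n = n"
  using assms by (simp_all add: left_module_def)

lemma left_comoduleD:
  assumes "left_comodule K H M"
  shows "module K M" and "coact M \<in> linear_maps K M (tensor K H M)"
    and "m \<in> carrier M \<Longrightarrow> tensor_assoc K H H M
         (tensor_map K H M (tensor K H H) M (comult H) (\<lambda>x. x) (coact M m)) =
       tensor_map K H M H (tensor K H M) (\<lambda>x. x) (coact M) (coact M m)"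
    and "m \<in> carrier M \<Longrightarrow> tensor_lift K H M M (\<lambda>h n. counit H h \<odot>\<^bsub>M\<^esub> n) (coact M m) = m"
  using assms by (simp_all add: left_comodule_def)

section \<open>Convolution of maps from H with linear maps from a comodule to a module\<close>

lemma coact_coassoc:
  assumes M: "left_comodule K H M" and U: "module K U" and m: "m \<in> carrier M"
    and T: "\<And>a. a \<in> carrier H \<Longrightarrow> T a \<in> bilinear_maps K H M U"
      "\<And>b n. b \<in> carrier H \<Longrightarrow> n \<in> carrier M \<Longrightarrow> (\<lambda>a. T a b n) \<in> linear_maps K H U"
  shows "tensor_lift K H M U (\<lambda>a n. tensor_lift K H H U (\<lambda>b c. T b c n) (comult H a)) (coact M m) =
    tensor_lift K H M U (\<lambda>a n. tensor_lift K H M U (T a) (coact M n)) (coact M m)"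
  by (rule coassoc_lift[OF H_module left_comoduleD(1)[OF M] U comult_linear left_comoduleD(2)[OF M]
        left_comoduleD(3)[OF M m] linear_mapsD(1)[OF left_comoduleD(2)[OF M] m] T])

text \<open>Coassociativity turns F(m_(-1)) G(m_(0)(-1)) \<phi>(m_(0)(0)) into (F(m_(-1)1)
  G(m_(-1)2)) \<phi>(m_(0)); by \<open>inv\<close> this is counit(m_(-1)) \<phi>(m_(0)). F and G
  stay general because both orders are needed: S before the identity for injectivity, the identity
  before S for m_(-1) E(m_(0)) = m.\<close>

lemma convolution_cancel:
  assumes M: "left_comodule K H M" and N: "left_module K H N"
    and F: "F \<in> linear_maps K H H" and G: "G \<in> linear_maps K H H"
    and inv: "\<And>h. h \<in> carrier H \<Longrightarrow>
      tensor_lift K H H H (\<lambda>a b. F a \<otimes>\<^bsub>H\<^esub> G b) (comult H h) = counit H h \<odot>\<^bsub>H\<^esub> \<one>\<^bsub>H\<^esub>"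
    and \<phi>: "\<phi> \<in> linear_maps K M N" and m: "m \<in> carrier M"
  shows "tensor_lift K H M N
      (\<lambda>a n. act N (F a) (tensor_lift K H M N (\<lambda>b p. act N (G b) (\<phi> p)) (coact M n))) (coact M m) = \<phi> m"
proof -
  note Mm = left_comoduleD(1)[OF M] and Nm = left_moduleD(1)[OF N]
  note act = left_moduleD(2)[OF N] and \<rho> = left_comoduleD(2)[OF M]
  have \<rho>m: "coact M m \<in> carrier (tensor K H M)" by (rule linear_mapsD(1)[OF \<rho> m])
  note rules = linear_intros Mm Nm bilinear_maps_left[OF act] bilinear_maps_right[OF act]
    bilinear_mapsD(3)[OF act] linear_maps_comp[OF \<rho>] linear_mapsD(1)[OF \<rho>]
    linear_maps_comp[OF F] linear_mapsD(1)[OF F] linear_maps_comp[OF G] linear_mapsD(1)[OF G]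
    linear_maps_comp[OF \<phi>] linear_mapsD(1)[OF \<phi>]
  have "tensor_lift K H M N
      (\<lambda>a n. act N (F a) (tensor_lift K H M N (\<lambda>b p. act N (G b) (\<phi> p)) (coact M n))) (coact M m) =
    tensor_lift K H M N
      (\<lambda>a n. tensor_lift K H M N (\<lambda>b p. act N (F a) (act N (G b) (\<phi> p))) (coact M n)) (coact M m)"
  proof (rule tensor_lift_cong[OF H_module Mm _ _ Nm \<rho>m])
    fix a n assume an: "a \<in> carrier H" "n \<in> carrier M"
    show "act N (F a) (tensor_lift K H M N (\<lambda>b p. act N (G b) (\<phi> p)) (coact M n)) =
      tensor_lift K H M N (\<lambda>b p. act N (F a) (act N (G b) (\<phi> p))) (coact M n)"
      by (rule linear_map_lift[OF bilinear_mapsD(1)[OF act] _ _ H_module Mm Nm Nm])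
        (use an in \<open>fast intro: rules\<close>)+
    show "tensor_lift K H M N (\<lambda>b p. act N (F a) (act N (G b) (\<phi> p))) (coact M n) \<in> carrier N"
      using an by (fast intro: rules)
  qed
  \<comment> \<open>Trade the second coaction for a comultiplication of a, so that F and G act on
    the two halves of one element of H.\<close>
  also have "\<dots> = tensor_lift K H M N
      (\<lambda>a n. tensor_lift K H H N (\<lambda>b c. act N (F b) (act N (G c) (\<phi> n))) (comult H a)) (coact M m)"
    by (rule coact_coassoc[OF M Nm m, symmetric]) (fast intro: rules)+
  also have "\<dots> = tensor_lift K H M N (\<lambda>a n. counit H a \<odot>\<^bsub>N\<^esub> \<phi> n) (coact M m)"
  proof (rule tensor_lift_cong[OF H_module Mm _ _ Nm \<rho>m])
    fix a n assume an: "a \<in> carrier H" "n \<in> carrier M"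
    interpret N: module K N by (rule Nm)
    have \<phi>n: "\<phi> n \<in> carrier N" by (rule linear_mapsD(1)[OF \<phi> an(2)])
    have \<Delta>: "comult H a \<in> carrier (tensor K H H)" by (rule linear_mapsD(1)[OF comult_linear an(1)])
    have "tensor_lift K H H N (\<lambda>b c. act N (F b) (act N (G c) (\<phi> n))) (comult H a) =
        tensor_lift K H H N (\<lambda>b c. act N (F b \<otimes>\<^bsub>H\<^esub> G c) (\<phi> n)) (comult H a)"
      by (rule tensor_lift_cong[OF H_module H_module _ _ Nm \<Delta>])
        (use an in \<open>simp add: left_moduleD(3)[OF N] linear_mapsD(1)[OF F] linear_mapsD(1)[OF G] \<phi>n
           bilinear_mapsD(3)[OF act]\<close>)+
    also have "\<dots> = act N (tensor_lift K H H H (\<lambda>b c. F b \<otimes>\<^bsub>H\<^esub> G c) (comult H a)) (\<phi> n)"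
      by (rule linear_map_lift[OF bilinear_mapsD(2)[OF act \<phi>n] _ \<Delta> H_module H_module H_module Nm, symmetric])
        (fast intro: rules)
    also have "\<dots> = counit H a \<odot>\<^bsub>N\<^esub> \<phi> n"
      using linear_mapsD(3)[OF bilinear_mapsD(2)[OF act \<phi>n] counit_closed[OF an(1)] H.one_closed]
      by (simp add: inv an left_moduleD(4)[OF N] \<phi>n)
    finally show "tensor_lift K H H N (\<lambda>b c. act N (F b) (act N (G c) (\<phi> n))) (comult H a) =
      counit H a \<odot>\<^bsub>N\<^esub> \<phi> n" .
    show "counit H a \<odot>\<^bsub>N\<^esub> \<phi> n \<in> carrier N" using an by (fast intro: rules)
  qed
  \<comment> \<open>Linearity of \<phi> moves the scalar into M, where the counit axiom of the
    comodule recovers m.\<close>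
  also have "\<dots> = tensor_lift K H M N (\<lambda>a n. \<phi> (counit H a \<odot>\<^bsub>M\<^esub> n)) (coact M m)"
    by (rule tensor_lift_cong[OF H_module Mm _ _ Nm \<rho>m])
      (simp add: linear_mapsD(3)[OF \<phi>] counit_closed, fast intro: rules)
  also have "\<dots> = \<phi> (tensor_lift K H M M (\<lambda>a n. counit H a \<odot>\<^bsub>M\<^esub> n) (coact M m))"
    by (rule linear_map_lift[OF \<phi> counit_smult_bilinear[OF Mm] \<rho>m H_module Mm Mm Nm, symmetric])
  also have "\<dots> = \<phi> m" by (simp add: left_comoduleD(4)[OF M m])
  finally show ?thesis .
qed

text \<open>A left inverse of the operator suffices: S is applied outside it, so
  \<open>antipode_left\<close> is the half of the antipode axiom that enters.\<close>

lemma convolution_injective: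
  assumes M: "left_comodule K H M" and N: "left_module K H N"
    and \<phi>: "\<phi> \<in> linear_maps K M N" and \<psi>: "\<psi> \<in> linear_maps K M N" and m: "m \<in> carrier M"
    and eq: "\<And>n. n \<in> carrier M \<Longrightarrow> tensor_lift K H M N (\<lambda>b p. act N b (\<phi> p)) (coact M n) =
      tensor_lift K H M N (\<lambda>b p. act N b (\<psi> p)) (coact M n)"
  shows "\<phi> m = \<psi> m"
proof -
  note Mm = left_comoduleD(1)[OF M] and Nm = left_moduleD(1)[OF N]
  note act = left_moduleD(2)[OF N] and \<rho> = left_comoduleD(2)[OF M]
  note rules = linear_intros Mm Nm bilinear_maps_left[OF act] bilinear_maps_right[OF act]
    bilinear_mapsD(3)[OF act] linear_mapsD(1)[OF \<rho>] linear_maps_comp[OF \<psi>] linear_mapsD(1)[OF \<psi>]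
  note cancel = convolution_cancel[OF M N antipode_linear linear_maps_id antipode_left _ m]
  have "\<phi> m = tensor_lift K H M N (\<lambda>a n. act N (antipode H a)
      (tensor_lift K H M N (\<lambda>b p. act N b (\<phi> p)) (coact M n))) (coact M m)"
    by (rule cancel[OF _ \<phi>, symmetric])
  also have "\<dots> = tensor_lift K H M N (\<lambda>a n. act N (antipode H a)
      (tensor_lift K H M N (\<lambda>b p. act N b (\<psi> p)) (coact M n))) (coact M m)"
    by (rule tensor_lift_cong[OF H_module Mm _ _ Nm linear_mapsD(1)[OF \<rho> m]])
      (simp add: eq, fast intro: rules)
  also have "\<dots> = \<psi> m" by (rule cancel[OF _ \<psi>])
  finally show ?thesis .
qed

end

text \<open>Writes an arbitrary tensor as a Sweedler sum of pure ones, so that a bare coact(m) can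
  enter a chain of sum manipulations.\<close>

lemma tensor_lift_pure_id:
  assumes V: "module K V" and W: "module K W" and x: "x \<in> carrier (tensor K V W)"
  shows "tensor_lift K V W (tensor K V W) (\<lambda>v w. pure_tensor K V W v w) x = x"
  by (rule tensor_ext[OF V W tensor_module[OF V W]
        tensor_lift_linear[OF V W tensor_module[OF V W] pure_tensor_bilinear[OF V W]] linear_maps_id _ x])
    (rule tensor_lift_pure[OF V W tensor_module[OF V W] pure_tensor_bilinear[OF V W]])

lemma tensor_prod_pure_right:
  assumes A: "module K A" and V: "module K V" and A': "module K A'" and W: "module K W"
    and B: "module K B" and U: "module K U"
    and \<mu>: "\<mu> \<in> bilinear_maps K A A' B" and \<nu>: "\<nu> \<in> bilinear_maps K V W U"
    and x: "x \<in> carrier (tensor K A V)" and a': "a' \<in> carrier A'" and w: "w \<in> carrier W"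
  shows "tensor_prod K A V A' W B U \<mu> \<nu> x (pure_tensor K A' W a' w) =
    tensor_lift K A V (tensor K B U) (\<lambda>a v. pure_tensor K B U (\<mu> a a') (\<nu> v w)) x"
  unfolding tensor_prod_def
  by (rule tensor_lift_cong[OF A V _ _ tensor_module[OF B U] x])
    (simp_all add: tensor_lift_pure[OF A' W tensor_module[OF B U]
        tensor_prod_inner_bilinear[OF A V A' W B U \<mu> \<nu>]] a' w
      pure_tensor_closed[OF B U] bilinear_mapsD(3)[OF \<mu>] bilinear_mapsD(3)[OF \<nu>])

section \<open>Attaching an action and a coaction to a module\<close>

text \<open>This is the shape of the record produced by \<open>free_hopf_module\<close>. Carrier,
  addition, zero and scalar multiplication are those of \<open>t\<close>, so tensor constructions on
  the extended record equal those on \<open>t\<close>; the simp rules that follow rewrite the former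
  to the latter.\<close>

abbreviation hopf_extend ::
  "('k, 'm) module \<Rightarrow> ('h \<Rightarrow> 'm \<Rightarrow> 'm) \<Rightarrow> ('m \<Rightarrow> ('k, 'h, 'm) tensor) \<Rightarrow> ('k, 'h, 'm) hopf_mod"
  where "hopf_extend t a c \<equiv> module.extend t (hopf_mod.fields a c)"

lemma hopf_extend_sel [simp]:
  "carrier (hopf_extend t a c) = carrier t" "add (hopf_extend t a c) = add t"
  "zero (hopf_extend t a c) = zero t" "smult (hopf_extend t a c) = smult t"
  "act (hopf_extend t a c) = a" "coact (hopf_extend t a c) = c"
  by (simp_all add: module.defs hopf_mod.defs)

lemma truncate_sel [simp]:
  "carrier (module.truncate V) = carrier V" "add (module.truncate V) = add V"
  "zero (module.truncate V) = zero V" "smult (module.truncate V) = smult V"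
  by (simp_all add: module.defs)

text \<open>Transfers the vector space axioms between records of different types with the same four
  fields: extension by an action and a coaction, and truncation to the space of
  coinvariants.\<close>

lemma module_cong:
  assumes "carrier V = carrier W" "add V = add W" "zero V = zero W" "smult V = smult W"
  shows "module K V \<longleftrightarrow> module K W"
  unfolding module_def module_axioms_def abelian_group_def abelian_group_axioms_def abelian_monoid_def
    comm_group_def group_def group_axioms_def comm_monoid_def comm_monoid_axioms_def monoid_def Units_def
  by (simp add: assms)

lemma hopf_extend_module: "module K (hopf_extend t a c) \<longleftrightarrow> module K t"
  by (rule module_cong) simp_all

lemma hopf_extend_linear [simp]:
  "linear_maps K (hopf_extend t a c) X = linear_maps K t X"
  "linear_maps K X (hopf_extend t a c) = linear_maps K X t"
  by (simp_all add: linear_maps_def)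

lemma hopf_extend_bilinear [simp]:
  "bilinear_maps K X (hopf_extend t a c) Y = bilinear_maps K X t Y"
  "bilinear_maps K X Y (hopf_extend t a c) = bilinear_maps K X Y t"
  by (simp_all add: bilinear_maps_def)

lemma hopf_extend_tensor [simp]:
  "tensor K X (hopf_extend t a c) = tensor K X t"
  "pure_tensor K X (hopf_extend t a c) = pure_tensor K X t"
  by (simp_all add: tensor_def pure_tensor_def tensor_relations_def fun_eq_iff)

lemma hopf_extend_tensor_lift [simp]:
  "tensor_lift K X (hopf_extend t a c) U = tensor_lift K X t U"
  "tensor_lift K X Y (hopf_extend t a c) = tensor_lift K X Y t"
  by (simp_all add: tensor_lift_def finsum_def finprod_def Let_def fun_eq_iff)

lemma hopf_extend_tensor_map [simp]:
  "tensor_map K X (hopf_extend t a c) Y W = tensor_map K X t Y W"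
  "tensor_map K X W Y (hopf_extend t a c) = tensor_map K X W Y t"
  by (simp_all add: tensor_map_def fun_eq_iff)

lemma hopf_extend_tensor_assoc [simp]:
  "tensor_assoc K X Y (hopf_extend t a c) = tensor_assoc K X Y t"
  by (simp add: tensor_assoc_def fun_eq_iff)

lemma hopf_extend_tensor_prod [simp]:
  "tensor_prod K A V A' (hopf_extend t a c) B U = tensor_prod K A V A' t B U"
  "tensor_prod K A V A' W B (hopf_extend t a c) = tensor_prod K A V A' W B t"
  by (simp_all add: tensor_prod_def fun_eq_iff)

section \<open>Free Hopf modules\<close>

context hopf_alg_over
begin

context
  fixes V :: "('k, 'v, 'y) module_scheme"
  assumes V: "module K V"
begin

private abbreviation (input) "t \<equiv> tensor K H V"
private abbreviation (input) "fr \<equiv> free_hopf_module K H V"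

private lemma t: "module K t" by (rule tensor_module[OF H_module V])
private lemma HH: "module K (tensor K H H)" by (rule tensor_module[OF H_module H_module])
private lemma Ht: "module K (tensor K H t)" by (rule tensor_module[OF H_module t])

private lemma mult_linear: "h \<in> carrier H \<Longrightarrow> (\<lambda>g. h \<otimes>\<^bsub>H\<^esub> g) \<in> linear_maps K H H"
  by (rule bilinear_mapsD(1)[OF mult_bilinear])

lemma free_act_pure:
  "h \<in> carrier H \<Longrightarrow> g \<in> carrier H \<Longrightarrow> v \<in> carrier V \<Longrightarrow>
    act fr h (pure_tensor K H V g v) = pure_tensor K H V (h \<otimes>\<^bsub>H\<^esub> g) v"
  by (simp add: free_hopf_module_def
      tensor_map_pure[OF H_module V H_module V mult_linear linear_maps_id])

lemma free_act_bilinear: "act fr \<in> bilinear_maps K H t t"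
  unfolding free_hopf_module_def hopf_extend_sel tensor_map_def
  by (fast intro: linear_intros V)

lemma free_coact_linear: "coact fr \<in> linear_maps K t (tensor K H t)"
  unfolding free_hopf_module_def hopf_extend_sel
  by (rule linear_maps_comp[OF tensor_assoc_linear[OF H_module H_module V]
        tensor_map_linear[OF H_module V HH V comult_linear linear_maps_id]])

lemma free_coact_pure:
  "h \<in> carrier H \<Longrightarrow> v \<in> carrier V \<Longrightarrow> coact fr (pure_tensor K H V h v) =
    tensor_lift K H H (tensor K H t) (\<lambda>a b. pure_tensor K H t a (pure_tensor K H V b v)) (comult H h)"
  by (simp add: free_hopf_module_def tensor_map_pure[OF H_module V HH V comult_linear linear_maps_id]
      tensor_assoc_pure[OF H_module H_module V] linear_mapsD(1)[OF comult_linear])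

private lemmas rules = linear_intros V t linear_maps_comp[OF free_coact_linear]
  linear_mapsD(1)[OF free_coact_linear] bilinear_maps_left[OF free_act_bilinear]
  bilinear_maps_right[OF free_act_bilinear] bilinear_mapsD(3)[OF free_act_bilinear]

lemma free_left_module: "left_module K H fr"
proof -
  have "act fr (g \<otimes>\<^bsub>H\<^esub> h) x = act fr g (act fr h x)"
    if gh: "g \<in> carrier H" "h \<in> carrier H" and x: "x \<in> carrier t" for g h x
  proof (rule tensor_ext[OF H_module V t _ _ _ x])
    show "act fr (g \<otimes>\<^bsub>H\<^esub> h) \<in> linear_maps K t t" using gh by (fast intro: rules)
    show "(\<lambda>x. act fr g (act fr h x)) \<in> linear_maps K t t" using gh by (fast intro: rules)
  qed (simp add: gh free_act_pure H.m_assoc)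
  moreover have "act fr \<one>\<^bsub>H\<^esub> x = x" if x: "x \<in> carrier t" for x
    by (rule tensor_ext[OF H_module V t bilinear_mapsD(1)[OF free_act_bilinear H.one_closed]
          linear_maps_id _ x])
      (simp add: free_act_pure)
  ultimately show ?thesis
    using free_act_bilinear t
    by (simp add: left_module_def free_hopf_module_def hopf_extend_module)
qed

text \<open>On h (x) v both sides of coassociativity expand to h_1 (x) (h_2 (x) (h_3 (x) v)), with
  h_1 split again on one side and h_2 on the other. The counit law comes down to counit(h_1) h_2 =
  h.\<close>

lemma free_left_comodule: "left_comodule K H fr"
proof -
  have "tensor_assoc K H H t (tensor_map K H t (tensor K H H) t (comult H) (\<lambda>x. x) (coact fr x)) =
      tensor_map K H t H (tensor K H t) (\<lambda>x. x) (coact fr) (coact fr x)" (is "?L (coact fr x) = ?R (coact fr x)")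
    if x: "x \<in> carrier t" for x
  proof (rule tensor_ext[OF H_module V tensor_module[OF H_module Ht] _ _ _ x])
    let ?U = "tensor K H (tensor K H t)"
    note U = tensor_module[OF H_module Ht]
    have L: "?L \<in> linear_maps K (tensor K H t) ?U"
      by (rule linear_maps_comp[OF tensor_assoc_linear[OF H_module H_module t]
            tensor_map_linear[OF H_module t HH t comult_linear linear_maps_id]])
    have R: "?R \<in> linear_maps K (tensor K H t) ?U"
      by (rule tensor_map_linear[OF H_module t H_module Ht linear_maps_id free_coact_linear])
    show "(\<lambda>x. ?L (coact fr x)) \<in> linear_maps K t ?U" by (rule linear_maps_comp[OF L free_coact_linear])
    show "(\<lambda>x. ?R (coact fr x)) \<in> linear_maps K t ?U" by (rule linear_maps_comp[OF R free_coact_linear])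
    fix h v assume hv: "h \<in> carrier H" "v \<in> carrier V"
    have \<Delta>: "comult H h \<in> carrier (tensor K H H)" by (rule linear_mapsD(1)[OF comult_linear hv(1)])
    have B: "(\<lambda>a b. pure_tensor K H t a (pure_tensor K H V b v)) \<in> bilinear_maps K H H (tensor K H t)"
      using hv by (fast intro: rules)
    have B2: "(\<lambda>b c. pure_tensor K H t b (pure_tensor K H V c v)) \<in> bilinear_maps K H H (tensor K H t)"
      using hv by (fast intro: rules)
    have "?L (coact fr (pure_tensor K H V h v)) =
      tensor_lift K H H ?U (\<lambda>a b. ?L (pure_tensor K H t a (pure_tensor K H V b v))) (comult H h)"
      unfolding free_coact_pure[OF hv] by (rule linear_map_lift[OF L B \<Delta> H_module H_module Ht U])
    also have "\<dots> = tensor_lift K H H ?U (\<lambda>a n. tensor_lift K H H ?U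
        (\<lambda>b c. pure_tensor K H (tensor K H t) b (pure_tensor K H t c (pure_tensor K H V n v)))
        (comult H a)) (comult H h)"
    proof (rule tensor_lift_cong[OF H_module H_module _ _ U \<Delta>])
      fix a b assume ab: "a \<in> carrier H" "b \<in> carrier H"
      show "?L (pure_tensor K H t a (pure_tensor K H V b v)) = tensor_lift K H H ?U
        (\<lambda>d c. pure_tensor K H (tensor K H t) d (pure_tensor K H t c (pure_tensor K H V b v))) (comult H a)"
        using ab hv by (simp add: tensor_map_pure[OF H_module t HH t comult_linear linear_maps_id]
            tensor_assoc_pure[OF H_module H_module t] pure_tensor_closed[OF H_module V]
            linear_mapsD(1)[OF comult_linear])
      show "tensor_lift K H H ?U
        (\<lambda>d c. pure_tensor K H (tensor K H t) d (pure_tensor K H t c (pure_tensor K H V b v))) (comult H a)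
          \<in> carrier ?U"
        using ab hv by (fast intro: rules)
    qed
    \<comment> \<open>Here H plays the comodule, coacting on itself by its comultiplication.\<close>
    also have "\<dots> = tensor_lift K H H ?U (\<lambda>a n. tensor_lift K H H ?U
        (\<lambda>b c. pure_tensor K H (tensor K H t) a (pure_tensor K H t b (pure_tensor K H V c v)))
        (comult H n)) (comult H h)"
      by (rule coassoc_lift[OF H_module H_module U comult_linear comult_linear comult_coassoc[OF hv(1)] \<Delta>])
        (use hv in \<open>fast intro: rules\<close>)+
    also have "\<dots> = tensor_lift K H H ?U (\<lambda>a b. ?R (pure_tensor K H t a (pure_tensor K H V b v))) (comult H h)"
    proof (rule tensor_lift_cong[OF H_module H_module _ _ U \<Delta>])
      fix a b assume ab: "a \<in> carrier H" "b \<in> carrier H"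
      have "?R (pure_tensor K H t a (pure_tensor K H V b v)) =
        pure_tensor K H (tensor K H t) a (tensor_lift K H H (tensor K H t)
          (\<lambda>b c. pure_tensor K H t b (pure_tensor K H V c v)) (comult H b))"
        using ab hv by (simp add: tensor_map_pure[OF H_module t H_module Ht linear_maps_id free_coact_linear]
            pure_tensor_closed[OF H_module V] free_coact_pure)
      also have "\<dots> = tensor_lift K H H ?U (\<lambda>b c. pure_tensor K H (tensor K H t) a
          (pure_tensor K H t b (pure_tensor K H V c v))) (comult H b)"
        by (rule linear_map_lift[OF bilinear_mapsD(1)[OF pure_tensor_bilinear[OF H_module Ht] ab(1)] B2
              linear_mapsD(1)[OF comult_linear ab(2)] H_module H_module Ht U])
      finally show "tensor_lift K H H ?U (\<lambda>b c. pure_tensor K H (tensor K H t) a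
          (pure_tensor K H t b (pure_tensor K H V c v))) (comult H b) =
        ?R (pure_tensor K H t a (pure_tensor K H V b v))" by simp
      show "?R (pure_tensor K H t a (pure_tensor K H V b v)) \<in> carrier ?U"
        by (rule linear_mapsD(1)[OF R]) (use ab hv in \<open>fast intro: rules\<close>)
    qed
    also have "\<dots> = ?R (coact fr (pure_tensor K H V h v))"
      unfolding free_coact_pure[OF hv]
      by (rule linear_map_lift[OF R B \<Delta> H_module H_module Ht U, symmetric])
    finally show "?L (coact fr (pure_tensor K H V h v)) = ?R (coact fr (pure_tensor K H V h v))" .
  qed
  moreover have "tensor_lift K H t t (\<lambda>h n. counit H h \<odot>\<^bsub>t\<^esub> n) (coact fr x) = x" (is "?C (coact fr x) = x")
    if x: "x \<in> carrier t" for x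
  proof (rule tensor_ext[OF H_module V t _ linear_maps_id _ x])
    have C: "?C \<in> linear_maps K (tensor K H t) t"
      by (rule tensor_lift_linear[OF H_module t t counit_smult_bilinear[OF t]])
    show "(\<lambda>x. ?C (coact fr x)) \<in> linear_maps K t t" by (rule linear_maps_comp[OF C free_coact_linear])
    fix h v assume hv: "h \<in> carrier H" "v \<in> carrier V"
    have \<Delta>: "comult H h \<in> carrier (tensor K H H)" by (rule linear_mapsD(1)[OF comult_linear hv(1)])
    have B: "(\<lambda>a b. pure_tensor K H t a (pure_tensor K H V b v)) \<in> bilinear_maps K H H (tensor K H t)"
      using hv by (fast intro: rules)
    note P = bilinear_mapsD(2)[OF pure_tensor_bilinear[OF H_module V] hv(2)]
    have "?C (coact fr (pure_tensor K H V h v)) =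
      tensor_lift K H H t (\<lambda>a b. ?C (pure_tensor K H t a (pure_tensor K H V b v))) (comult H h)"
      unfolding free_coact_pure[OF hv] by (rule linear_map_lift[OF C B \<Delta> H_module H_module Ht t])
    \<comment> \<open>The scalar counit(a) is absorbed into the factor b from H, so that the counit
      axiom of H applies to the sum before tensoring with v.\<close>
    also have "\<dots> = tensor_lift K H H t (\<lambda>a b. pure_tensor K H V (counit H a \<odot>\<^bsub>H\<^esub> b) v) (comult H h)"
    proof (rule tensor_lift_cong[OF H_module H_module _ _ t \<Delta>])
      fix a b assume ab: "a \<in> carrier H" "b \<in> carrier H"
      show "?C (pure_tensor K H t a (pure_tensor K H V b v)) = pure_tensor K H V (counit H a \<odot>\<^bsub>H\<^esub> b) v"
        using ab hv by (simp add: tensor_lift_pure[OF H_module t t counit_smult_bilinear[OF t]]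
            pure_tensor_closed[OF H_module V] linear_mapsD(3)[OF P] counit_closed)
    qed (use hv in \<open>fast intro: rules\<close>)
    also have "\<dots> = pure_tensor K H V (tensor_lift K H H H (\<lambda>a b. counit H a \<odot>\<^bsub>H\<^esub> b) (comult H h)) v"
      by (rule linear_map_lift[OF P counit_smult_bilinear[OF H_module] \<Delta> H_module H_module H_module t, symmetric])
    finally show "?C (coact fr (pure_tensor K H V h v)) = pure_tensor K H V h v"
      by (simp add: counit_left hv)
  qed
  ultimately show ?thesis
    using free_coact_linear t
    by (simp add: left_comodule_def free_hopf_module_def hopf_extend_module)
qed

text \<open>For fixed v the map c (x) d to c (x) (d (x) v) carries left multiplication in H (x) H to
  the componentwise action on H (x) (H (x) V). Compatibility on g (x) v is thereby the image of
  Delta(h g) = Delta(h) Delta(g).\<close>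

lemma free_hopf_module_hopf: "hopf_module K H fr"
proof -
  have "coact fr (act fr h x) = tensor_prod K H H H t H t (mult H) (act fr) (comult H h) (coact fr x)"
    if h: "h \<in> carrier H" and x: "x \<in> carrier t" for h x
  proof (rule tensor_ext[OF H_module V Ht _ _ _ x])
    note PB = tensor_prod_bilinear[OF H_module H_module H_module t H_module t mult_bilinear free_act_bilinear]
    have \<Delta>: "comult H k \<in> carrier (tensor K H H)" if "k \<in> carrier H" for k
      by (rule linear_mapsD(1)[OF comult_linear that])
    show "(\<lambda>x. coact fr (act fr h x)) \<in> linear_maps K t (tensor K H t)" using h by (fast intro: rules)
    show "(\<lambda>x. tensor_prod K H H H t H t (mult H) (act fr) (comult H h) (coact fr x))
        \<in> linear_maps K t (tensor K H t)"
      by (rule bilinear_maps_right[OF PB free_coact_linear \<Delta>[OF h]])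
    fix g v assume gv: "g \<in> carrier H" "v \<in> carrier V"
    let ?B = "\<lambda>c d. pure_tensor K H t c (pure_tensor K H V d v)"
    have B: "?B \<in> bilinear_maps K H H (tensor K H t)" using gv by (fast intro: rules)
    have L: "tensor_lift K H H (tensor K H t) ?B \<in> linear_maps K (tensor K H H) (tensor K H t)"
      by (rule tensor_lift_linear[OF H_module H_module Ht B])
    \<comment> \<open>Delta(h) is replaced by an arbitrary X so that \<open>tensor_ext\<close> can
      reduce to X = a (x) b; only g is left as a Sweedler sum.\<close>
    have "tensor_lift K H H (tensor K H t) ?B (tensor_prod K H H H H H H (mult H) (mult H) X (comult H g)) =
      tensor_prod K H H H t H t (mult H) (act fr) X (tensor_lift K H H (tensor K H t) ?B (comult H g))"
      if X: "X \<in> carrier (tensor K H H)" for X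
    proof (rule tensor_ext[OF H_module H_module Ht _ _ _ X])
      note HB = tensor_prod_bilinear[OF H_module H_module H_module H_module H_module H_module
          mult_bilinear mult_bilinear]
      show "(\<lambda>X. tensor_lift K H H (tensor K H t) ?B
          (tensor_prod K H H H H H H (mult H) (mult H) X (comult H g)))
        \<in> linear_maps K (tensor K H H) (tensor K H t)"
        by (rule linear_maps_comp[OF L bilinear_mapsD(2)[OF HB \<Delta>[OF gv(1)]]])
      show "(\<lambda>X. tensor_prod K H H H t H t (mult H) (act fr) X
          (tensor_lift K H H (tensor K H t) ?B (comult H g))) \<in> linear_maps K (tensor K H H) (tensor K H t)"
        by (rule bilinear_mapsD(2)[OF PB linear_mapsD(1)[OF L \<Delta>[OF gv(1)]]])
      fix a b assume ab: "a \<in> carrier H" "b \<in> carrier H"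
      have I: "(\<lambda>c d. pure_tensor K H H (a \<otimes>\<^bsub>H\<^esub> c) (b \<otimes>\<^bsub>H\<^esub> d)) \<in> bilinear_maps K H H (tensor K H H)"
        using ab by (fast intro: rules)
      have "tensor_lift K H H (tensor K H t) ?B
          (tensor_prod K H H H H H H (mult H) (mult H) (pure_tensor K H H a b) (comult H g)) =
        tensor_lift K H H (tensor K H t) ?B
          (tensor_lift K H H (tensor K H H) (\<lambda>c d. pure_tensor K H H (a \<otimes>\<^bsub>H\<^esub> c) (b \<otimes>\<^bsub>H\<^esub> d)) (comult H g))"
        by (simp add: tensor_prod_pure_left[OF H_module H_module H_module H_module H_module H_module
              mult_bilinear mult_bilinear] ab \<Delta> gv)
      also have "\<dots> = tensor_lift K H H (tensor K H t) (\<lambda>c d. tensor_lift K H H (tensor K H t) ?B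
          (pure_tensor K H H (a \<otimes>\<^bsub>H\<^esub> c) (b \<otimes>\<^bsub>H\<^esub> d))) (comult H g)"
        by (rule linear_map_lift[OF L I \<Delta>[OF gv(1)] H_module H_module HH Ht])
      also have "\<dots> = tensor_lift K H H (tensor K H t)
          (\<lambda>c d. tensor_prod K H H H t H t (mult H) (act fr) (pure_tensor K H H a b) (?B c d)) (comult H g)"
      proof (rule tensor_lift_cong[OF H_module H_module _ _ Ht \<Delta>[OF gv(1)]])
        fix c d assume cd: "c \<in> carrier H" "d \<in> carrier H"
        show "tensor_lift K H H (tensor K H t) ?B (pure_tensor K H H (a \<otimes>\<^bsub>H\<^esub> c) (b \<otimes>\<^bsub>H\<^esub> d)) =
          tensor_prod K H H H t H t (mult H) (act fr) (pure_tensor K H H a b) (?B c d)"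
          using ab cd gv by (simp add: tensor_lift_pure[OF H_module H_module Ht B]
              tensor_prod_pure[OF H_module H_module H_module t H_module t mult_bilinear free_act_bilinear]
              pure_tensor_closed[OF H_module V] free_act_pure)
        show "tensor_prod K H H H t H t (mult H) (act fr) (pure_tensor K H H a b) (?B c d)
            \<in> carrier (tensor K H t)"
          by (rule bilinear_mapsD(3)[OF PB]) (use ab cd gv in \<open>fast intro: rules\<close>)+
      qed
      also have "\<dots> = tensor_prod K H H H t H t (mult H) (act fr) (pure_tensor K H H a b)
          (tensor_lift K H H (tensor K H t) ?B (comult H g))"
        by (rule linear_map_lift[OF bilinear_mapsD(1)[OF PB pure_tensor_closed[OF H_module H_module ab]] B
              \<Delta>[OF gv(1)] H_module H_module Ht Ht, symmetric])
      finally show "tensor_lift K H H (tensor K H t) ?B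
          (tensor_prod K H H H H H H (mult H) (mult H) (pure_tensor K H H a b) (comult H g)) =
        tensor_prod K H H H t H t (mult H) (act fr) (pure_tensor K H H a b)
          (tensor_lift K H H (tensor K H t) ?B (comult H g))" .
    qed
    from this[OF \<Delta>[OF h]]
    show "coact fr (act fr h (pure_tensor K H V g v)) =
      tensor_prod K H H H t H t (mult H) (act fr) (comult H h) (coact fr (pure_tensor K H V g v))"
      by (simp add: free_act_pure free_coact_pure comult_mult h gv)
  qed
  then show ?thesis
    using free_left_module free_left_comodule
    by (simp add: hopf_module_def free_hopf_module_def)
qed

end

end

section \<open>Functoriality of the free Hopf module, and the quadratic criterion for
  genericity\<close>

lemma tensor_map_tensor_map:
  assumes mods: "module K V" "module K W" "module K V'" "module K W'" "module K V''" "module K W''"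
    and f: "f \<in> linear_maps K V V'" and g: "g \<in> linear_maps K W W'"
    and f': "f' \<in> linear_maps K V' V''" and g': "g' \<in> linear_maps K W' W''"
    and x: "x \<in> carrier (tensor K V W)"
  shows "tensor_map K V' W' V'' W'' f' g' (tensor_map K V W V' W' f g x) =
    tensor_map K V W V'' W'' (\<lambda>v. f' (f v)) (\<lambda>w. g' (g w)) x"
  unfolding tensor_map_def[of K V' W' V'' W''] tensor_map_def[of K V W V'' W'']
  by (rule tensor_lift_map[OF mods(1-4) f g tensor_module[OF mods(5,6)]
        tensor_map_bilinear[OF mods(5,6) f' g'] x])

context hopf_alg_over
begin

text \<open>T touches only the factor V, whereas action and coaction of the free Hopf module touch
  only the factor H, so the two commute on pure tensors.\<close>

lemma free_tensor_map_hopf: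
  assumes V: "module K V" and T: "T \<in> linear_maps K V V"
  shows "tensor_map K H V H V (\<lambda>h. h) T \<in>
    hopf_module_maps K H (free_hopf_module K H V) (free_hopf_module K H V)"
proof -
  let ?t = "tensor K H V" and ?fr = "free_hopf_module K H V"
  let ?T = "tensor_map K H V H V (\<lambda>h. h) T"
  note t = tensor_module[OF H_module V] and Ht = tensor_module[OF H_module tensor_module[OF H_module V]]
  note lin = tensor_map_linear[OF H_module V H_module V linear_maps_id T]
  note pure = tensor_map_pure[OF H_module V H_module V linear_maps_id T]
  note act = free_act_bilinear[OF V] and coact = free_coact_linear[OF V]
  have "?T (act ?fr h x) = act ?fr h (?T x)" if h: "h \<in> carrier H" and x: "x \<in> carrier ?t" for h x
    by (rule tensor_ext[OF H_module V t linear_maps_comp[OF lin bilinear_mapsD(1)[OF act h]]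
          linear_maps_comp[OF bilinear_mapsD(1)[OF act h] lin] _ x])
      (simp add: h free_act_pure[OF V] pure linear_mapsD(1)[OF T])
  moreover have "coact ?fr (?T x) = tensor_map K H ?t H ?t (\<lambda>x. x) ?T (coact ?fr x)"
    if x: "x \<in> carrier ?t" for x
  proof (rule tensor_ext[OF H_module V Ht linear_maps_comp[OF coact lin] linear_maps_comp[OF _ coact] _ x])
    note TT = tensor_map_linear[OF H_module t H_module t linear_maps_id lin]
    show "tensor_map K H ?t H ?t (\<lambda>x. x) ?T \<in> linear_maps K (tensor K H ?t) (tensor K H ?t)" by (rule TT)
    fix h v assume hv: "h \<in> carrier H" "v \<in> carrier V"
    note Tv = linear_mapsD(1)[OF T hv(2)]
    have \<Delta>: "comult H h \<in> carrier (tensor K H H)" by (rule linear_mapsD(1)[OF comult_linear hv(1)])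
    have B: "(\<lambda>a b. pure_tensor K H ?t a (pure_tensor K H V b v)) \<in> bilinear_maps K H H (tensor K H ?t)"
      using hv by (fast intro: linear_intros V)
    have "coact ?fr (?T (pure_tensor K H V h v)) =
      tensor_lift K H H (tensor K H ?t) (\<lambda>a b. pure_tensor K H ?t a (pure_tensor K H V b (T v))) (comult H h)"
      by (simp add: pure hv free_coact_pure[OF V] Tv)
    also have "\<dots> = tensor_lift K H H (tensor K H ?t) (\<lambda>a b. tensor_map K H ?t H ?t (\<lambda>x. x) ?T
        (pure_tensor K H ?t a (pure_tensor K H V b v))) (comult H h)"
      by (rule tensor_lift_cong[OF H_module H_module _ _ Ht \<Delta>, symmetric])
        (simp_all add: hv tensor_map_pure[OF H_module t H_module t linear_maps_id lin]
          pure pure_tensor_closed H_module V t Tv)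
    also have "\<dots> = tensor_map K H ?t H ?t (\<lambda>x. x) ?T (coact ?fr (pure_tensor K H V h v))"
      unfolding free_coact_pure[OF V hv]
      by (rule linear_map_lift[OF TT B \<Delta> H_module H_module Ht Ht, symmetric])
    finally show "coact ?fr (?T (pure_tensor K H V h v)) =
      tensor_map K H ?t H ?t (\<lambda>x. x) ?T (coact ?fr (pure_tensor K H V h v))" .
  qed
  ultimately show ?thesis
    using lin by (simp add: hopf_module_maps_def free_hopf_module_def)
qed

lemma hopf_module_mapsD:
  assumes "f \<in> hopf_module_maps K H M N"
  shows "f \<in> linear_maps K M N"
    and "h \<in> carrier H \<Longrightarrow> m \<in> carrier M \<Longrightarrow> f (act M h m) = act N h (f m)"
    and "m \<in> carrier M \<Longrightarrow> coact N (f m) = tensor_map K H M H N (\<lambda>x. x) f (coact M m)"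
  using assms by (simp_all add: hopf_module_maps_def)

lemma generic_rb_hopf_moduleD:
  assumes gen: "generic_rb_hopf_module K H lam M T" and lam: "lam \<in> carrier K" and m: "m \<in> carrier M"
  shows "T (T m) \<oplus>\<^bsub>M\<^esub> lam \<odot>\<^bsub>M\<^esub> T m = \<zero>\<^bsub>M\<^esub>"
proof -
  have rb: "rb_paired_module K H lam M (\<lambda>h. h) T"
    using gen linear_maps_id[of K H]
    by (auto simp: generic_rb_hopf_module_def rb_paired_hopf_module_def)
  then have M: "left_module K H M" and T: "T \<in> linear_maps K M M" by (simp_all add: rb_paired_module_def)
  interpret M: module K M by (rule left_moduleD(1)[OF M])
  note Tc = linear_mapsD(1)[OF T]
  \<comment> \<open>The module condition at P = id and h = 1 reads T m = T m + T(T m) + lam T m;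
    cancelling T m leaves the quadratic identity.\<close>
  have "act M \<one>\<^bsub>H\<^esub> (T m) = T (act M \<one>\<^bsub>H\<^esub> m) \<oplus>\<^bsub>M\<^esub> T (act M \<one>\<^bsub>H\<^esub> (T m))
      \<oplus>\<^bsub>M\<^esub> lam \<odot>\<^bsub>M\<^esub> T (act M \<one>\<^bsub>H\<^esub> m)"
    using rb m by (simp add: rb_paired_module_def)
  then have "T m = T m \<oplus>\<^bsub>M\<^esub> (T (T m) \<oplus>\<^bsub>M\<^esub> lam \<odot>\<^bsub>M\<^esub> T m)"
    using m Tc lam by (simp add: left_moduleD(4)[OF M] M.M.a_assoc)
  then show ?thesis using m Tc lam by simp
qed

text \<open>H-linearity gives P(h) T(m) = T(P(h) m), and the two remaining terms of the module
  condition are the quadratic identity at h m. The comodule condition is dual: colinearity matches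
  the terms with P, and the rest is the coaction of the quadratic identity at m.\<close>

lemma generic_rb_hopf_moduleI:
  assumes M: "hopf_module K H M" and T: "T \<in> hopf_module_maps K H M M" and lam: "lam \<in> carrier K"
    and quad: "\<And>m. m \<in> carrier M \<Longrightarrow> T (T m) \<oplus>\<^bsub>M\<^esub> lam \<odot>\<^bsub>M\<^esub> T m = \<zero>\<^bsub>M\<^esub>"
  shows "generic_rb_hopf_module K H lam M T"
proof -
  have lm: "left_module K H M" and lc: "left_comodule K H M" using M by (simp_all add: hopf_module_def)
  note Mm = left_moduleD(1)[OF lm] and act = left_moduleD(2)[OF lm] and \<rho> = left_comoduleD(2)[OF lc]
  note Tl = hopf_module_mapsD(1)[OF T]
  note HM = tensor_module[OF H_module Mm]
  interpret M: module K M by (rule Mm)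
  interpret HM: module K "tensor K H M" by (rule HM)
  note Tc = linear_mapsD(1)[OF Tl] and actc = bilinear_mapsD(3)[OF act] and \<rho>c = linear_mapsD(1)[OF \<rho>]
  have "rb_paired_hopf_module K H lam M P T" if P: "P \<in> linear_maps K H H" for P
  proof -
    note Pc = linear_mapsD(1)[OF P]
    have "act M (P h) (T m) = T (act M (P h) m) \<oplus>\<^bsub>M\<^esub> T (act M h (T m)) \<oplus>\<^bsub>M\<^esub> lam \<odot>\<^bsub>M\<^esub> T (act M h m)"
      if hm: "h \<in> carrier H" "m \<in> carrier M" for h m
    proof -
      have "T (act M (P h) m) \<oplus>\<^bsub>M\<^esub> T (act M h (T m)) \<oplus>\<^bsub>M\<^esub> lam \<odot>\<^bsub>M\<^esub> T (act M h m) =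
        T (act M (P h) m) \<oplus>\<^bsub>M\<^esub> (T (T (act M h m)) \<oplus>\<^bsub>M\<^esub> lam \<odot>\<^bsub>M\<^esub> T (act M h m))"
        using hm lam by (simp add: hopf_module_mapsD(2)[OF T] M.M.a_assoc Tc actc Pc)
      also have "\<dots> = act M (P h) (T m)"
        unfolding quad[OF actc[OF hm]] using hm by (simp add: hopf_module_mapsD(2)[OF T] Tc actc Pc)
      finally show ?thesis by simp
    qed
    moreover have "tensor_map K H M H M P T (coact M m) =
       tensor_map K H M H M P (\<lambda>x. x) (coact M (T m)) \<oplus>\<^bsub>tensor K H M\<^esub>
       tensor_map K H M H M (\<lambda>x. x) T (coact M (T m)) \<oplus>\<^bsub>tensor K H M\<^esub>
       lam \<odot>\<^bsub>tensor K H M\<^esub> coact M (T m)" if m: "m \<in> carrier M" for m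
    proof -
      \<comment> \<open>By colinearity coact(T m) = (id (x) T) coact(m), and P acts on the other
        factor.\<close>
      have PT: "tensor_map K H M H M P (\<lambda>x. x) (coact M (T m)) = tensor_map K H M H M P T (coact M m)"
        by (simp add: hopf_module_mapsD(3)[OF T m] \<rho>c[OF m]
            tensor_map_tensor_map[OF H_module Mm H_module Mm H_module Mm linear_maps_id Tl P linear_maps_id])
      \<comment> \<open>Colinearity read backwards at T m: (id (x) T) coact(T m) = coact(T(T
        m)).\<close>
      have "tensor_map K H M H M (\<lambda>x. x) T (coact M (T m)) \<oplus>\<^bsub>tensor K H M\<^esub>
          lam \<odot>\<^bsub>tensor K H M\<^esub> coact M (T m) = coact M (T (T m) \<oplus>\<^bsub>M\<^esub> lam \<odot>\<^bsub>M\<^esub> T m)"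
        using m lam by (simp add: hopf_module_mapsD(3)[OF T, of "T m", symmetric] Tc
            linear_mapsD(2,3)[OF \<rho>])
      also have "\<dots> = \<zero>\<^bsub>tensor K H M\<^esub>" by (simp add: quad[OF m] linear_maps_zero[OF \<rho> Mm HM])
      finally have Z: "tensor_map K H M H M (\<lambda>x. x) T (coact M (T m)) \<oplus>\<^bsub>tensor K H M\<^esub>
          lam \<odot>\<^bsub>tensor K H M\<^esub> coact M (T m) = \<zero>\<^bsub>tensor K H M\<^esub>" .
      note cl = linear_mapsD(1)[OF tensor_map_linear[OF H_module Mm H_module Mm P Tl] \<rho>c[OF m]]
        linear_mapsD(1)[OF tensor_map_linear[OF H_module Mm H_module Mm linear_maps_id Tl] \<rho>c[OF Tc[OF m]]]
        HM.smult_closed[OF lam \<rho>c[OF Tc[OF m]]]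
      show ?thesis unfolding PT HM.M.a_assoc[OF cl] Z using cl(1) by simp
    qed
    ultimately show ?thesis
      using M P Tl lm lc by (simp add: rb_paired_hopf_module_def rb_paired_module_def rb_paired_comodule_def)
  qed
  then show ?thesis by (simp add: generic_rb_hopf_module_def)
qed

end

section \<open>The fundamental theorem of Hopf modules\<close>

locale hopf_module_over = hopf_alg_over K H
  for K :: "('k, 'r) ring_scheme" and H :: "('k, 'h, 'x) hopf_alg_scheme" +
  fixes M :: "('k, 'h, 'm, 'y) hopf_mod_scheme"
  assumes hopf_mod: "hopf_module K H M"
begin

lemma M_left_module: "left_module K H M"
  and M_left_comodule: "left_comodule K H M"
  and coact_act: "h \<in> carrier H \<Longrightarrow> m \<in> carrier M \<Longrightarrow> coact M (act M h m) =
    tensor_prod K H H H M H M (mult H) (act M) (comult H h) (coact M m)"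
  using hopf_mod by (simp_all add: hopf_module_def)

lemmas M_module [linear_intros] = left_moduleD(1)[OF M_left_module]
  and act_bilinear = left_moduleD(2)[OF M_left_module]
  and act_mult = left_moduleD(3)[OF M_left_module]
  and act_one = left_moduleD(4)[OF M_left_module]
  and coact_linear = left_comoduleD(2)[OF M_left_comodule]

lemmas coact_closed = linear_mapsD(1)[OF coact_linear]

lemmas [linear_intros] = bilinear_maps_left[OF act_bilinear] bilinear_maps_right[OF act_bilinear]
  bilinear_mapsD(3)[OF act_bilinear] linear_maps_comp[OF coact_linear] coact_closed

section \<open>The diagonal action of H on H (x) M\<close>

abbreviation "HM \<equiv> tensor K H M"

lemma HM_module: "module K HM" by (rule tensor_module[OF H_module M_module])

text \<open>The componentwise action of the algebra H (x) H on H (x) M. Precomposed with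
  \<open>comult\<close> it is the diagonal action of H, and Hopf compatibility reads coact(h m) =
  diag_act (Delta h) (coact m).\<close>

definition "diag_act x y = tensor_prod K H H H M H M (mult H) (act M) x y"

lemma diag_act_bilinear: "diag_act \<in> bilinear_maps K (tensor K H H) HM HM"
  unfolding diag_act_def
  by (rule tensor_prod_bilinear[OF H_module H_module H_module M_module H_module M_module
        mult_bilinear act_bilinear])

lemma diag_act_pure:
  "a \<in> carrier H \<Longrightarrow> b \<in> carrier H \<Longrightarrow> c \<in> carrier H \<Longrightarrow> m \<in> carrier M \<Longrightarrow>
    diag_act (pure_tensor K H H a b) (pure_tensor K H M c m) = pure_tensor K H M (a \<otimes>\<^bsub>H\<^esub> c) (act M b m)"
  unfolding diag_act_def
  by (rule tensor_prod_pure[OF H_module H_module H_module M_module H_module M_module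
        mult_bilinear act_bilinear])

lemma diag_act_pure_right:
  "x \<in> carrier (tensor K H H) \<Longrightarrow> c \<in> carrier H \<Longrightarrow> m \<in> carrier M \<Longrightarrow>
    diag_act x (pure_tensor K H M c m) =
    tensor_lift K H H HM (\<lambda>a b. pure_tensor K H M (a \<otimes>\<^bsub>H\<^esub> c) (act M b m)) x"
  unfolding diag_act_def
  by (rule tensor_prod_pure_right[OF H_module H_module H_module M_module H_module M_module
        mult_bilinear act_bilinear])

lemmas [linear_intros] = bilinear_maps_left[OF diag_act_bilinear] bilinear_maps_right[OF diag_act_bilinear]
  bilinear_mapsD(3)[OF diag_act_bilinear]

text \<open>On pure tensors this is associativity in H and in M. All three arguments are general
  tensors, hence one use of \<open>tensor_ext\<close> for each.\<close>

lemma diag_act_mult: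
  assumes x: "x \<in> carrier (tensor K H H)" and y: "y \<in> carrier (tensor K H H)" and z: "z \<in> carrier HM"
  shows "diag_act (tensor_prod K H H H H H H (mult H) (mult H) x y) z = diag_act x (diag_act y z)"
proof -
  let ?P = "tensor_prod K H H H H H H (mult H) (mult H)"
  note PB = tensor_prod_bilinear[OF H_module H_module H_module H_module H_module H_module
      mult_bilinear mult_bilinear]
  note Pp = tensor_prod_pure[OF H_module H_module H_module H_module H_module H_module
      mult_bilinear mult_bilinear]
  note rules = linear_intros bilinear_maps_left[OF PB] bilinear_maps_right[OF PB] bilinear_mapsD(3)[OF PB]
  show ?thesis
  proof (rule tensor_ext[OF H_module H_module HM_module _ _ _ x])
    show "(\<lambda>x. diag_act (?P x y) z) \<in> linear_maps K (tensor K H H) HM" using y z by (fast intro: rules)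
    show "(\<lambda>x. diag_act x (diag_act y z)) \<in> linear_maps K (tensor K H H) HM" using y z by (fast intro: rules)
    fix a b assume ab: "a \<in> carrier H" "b \<in> carrier H"
    let ?x = "pure_tensor K H H a b"
    show "diag_act (?P ?x y) z = diag_act ?x (diag_act y z)"
    proof (rule tensor_ext[OF H_module H_module HM_module _ _ _ y])
      show "(\<lambda>y. diag_act (?P ?x y) z) \<in> linear_maps K (tensor K H H) HM" using ab z by (fast intro: rules)
      show "(\<lambda>y. diag_act ?x (diag_act y z)) \<in> linear_maps K (tensor K H H) HM" using ab z by (fast intro: rules)
      fix c d assume cd: "c \<in> carrier H" "d \<in> carrier H"
      let ?y = "pure_tensor K H H c d"
      show "diag_act (?P ?x ?y) z = diag_act ?x (diag_act ?y z)"
      proof (rule tensor_ext[OF H_module M_module HM_module _ _ _ z])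
        show "diag_act (?P ?x ?y) \<in> linear_maps K HM HM" using ab cd by (fast intro: rules)
        show "(\<lambda>z. diag_act ?x (diag_act ?y z)) \<in> linear_maps K HM HM" using ab cd by (fast intro: rules)
      qed (simp add: ab cd Pp diag_act_pure H.m_assoc act_mult bilinear_mapsD(3)[OF act_bilinear])
    qed
  qed
qed

text \<open>Only the action matters here; the coaction is left unspecified.\<close>

abbreviation "diag_module \<equiv> hopf_extend HM (\<lambda>h. diag_act (comult H h)) undefined"

text \<open>Restriction of the H (x) H action along Delta, which is an algebra map.\<close>

lemma diag_left_module: "left_module K H diag_module"
proof -
  have "diag_act (comult H \<one>\<^bsub>H\<^esub>) z = z" if z: "z \<in> carrier HM" for z
  proof (rule tensor_ext[OF H_module M_module HM_module _ linear_maps_id _ z])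
    show "diag_act (comult H \<one>\<^bsub>H\<^esub>) \<in> linear_maps K HM HM" by (fast intro: linear_intros)
  qed (simp add: comult_one diag_act_pure act_one)
  moreover have "(\<lambda>h. diag_act (comult H h)) \<in> bilinear_maps K H HM HM" by (fast intro: linear_intros)
  ultimately show ?thesis
    by (simp add: left_module_def hopf_extend_module HM_module comult_mult diag_act_mult
        linear_mapsD(1)[OF comult_linear])
qed

section \<open>The projection E onto the coinvariants\<close>

definition coinv_proj :: "'m \<Rightarrow> 'm"
  where "coinv_proj m = tensor_lift K H M M (\<lambda>a n. act M (antipode H a) n) (coact M m)"

text \<open>E is at first only a map into M; its codomain narrows to the coinvariants in
  \<open>coinv_proj_linear_V\<close>, once \<open>coinv_proj_coinvariant\<close> is
  available.\<close>

lemma coinv_proj_linear: "coinv_proj \<in> linear_maps K M M"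
proof -
  have "(\<lambda>m. coinv_proj m) \<in> linear_maps K M M"
    unfolding coinv_proj_def by (fast intro: linear_intros)
  then show ?thesis .
qed

lemmas coinv_proj_closed = linear_mapsD(1)[OF coinv_proj_linear]

lemmas [linear_intros] = linear_maps_comp[OF coinv_proj_linear] coinv_proj_closed

text \<open>Convolution cancellation with the identity outside, S inside and \<phi> the identity of
  M. It gives one half of the bijectivity and both computations behind coinvariance.\<close>

lemma act_coinv_proj:
  assumes m: "m \<in> carrier M"
  shows "tensor_lift K H M M (\<lambda>a n. act M a (coinv_proj n)) (coact M m) = m"
  unfolding coinv_proj_def
  by (rule convolution_cancel[OF M_left_comodule M_left_module linear_maps_id antipode_linear
        antipode_right linear_maps_id m])

abbreviation "V \<equiv> coinvariant_space K H M"

lemma coinv_proj_coinvariant: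
  assumes m: "m \<in> carrier M"
  shows "coact M (coinv_proj m) = pure_tensor K H M \<one>\<^bsub>H\<^esub> (coinv_proj m)"
proof (rule convolution_injective[OF M_left_comodule diag_left_module _ _ m])
  show "(\<lambda>m. coact M (coinv_proj m)) \<in> linear_maps K M diag_module"
    unfolding hopf_extend_linear by (fast intro: linear_intros)
  show "(\<lambda>m. pure_tensor K H M \<one>\<^bsub>H\<^esub> (coinv_proj m)) \<in> linear_maps K M diag_module"
    unfolding hopf_extend_linear by (fast intro: linear_intros)
  fix n assume n: "n \<in> carrier M"
  \<comment> \<open>First image: Hopf compatibility merges the diagonal action into coact(b E(p)),
    after which coact leaves the sum and n_(-1) E(n_(0)) = n applies.\<close>
  have "tensor_lift K H M HM (\<lambda>b p. diag_act (comult H b) (coact M (coinv_proj p))) (coact M n) =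
    tensor_lift K H M HM (\<lambda>b p. coact M (act M b (coinv_proj p))) (coact M n)"
    by (rule tensor_lift_cong[OF H_module M_module _ _ HM_module coact_closed[OF n]])
      (simp add: diag_act_def coact_act coinv_proj_closed, fast intro: linear_intros)
  also have "\<dots> = coact M (tensor_lift K H M M (\<lambda>b p. act M b (coinv_proj p)) (coact M n))"
    by (rule linear_map_lift[OF coact_linear _ coact_closed[OF n] H_module M_module M_module HM_module, symmetric])
      (fast intro: linear_intros)
  also have "\<dots> = coact M n" by (simp add: act_coinv_proj n)
  also have "\<dots> = tensor_lift K H M HM (\<lambda>a n. pure_tensor K H M a n) (coact M n)"
    by (rule tensor_lift_pure_id[OF H_module M_module coact_closed[OF n], symmetric])
  \<comment> \<open>Towards the second image: expanding only the second tensor factor as n_(-1)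
    E(n_(0)) introduces the second coaction that coassociativity requires.\<close>
  also have "\<dots> = tensor_lift K H M HM
      (\<lambda>a n. tensor_lift K H M HM (\<lambda>b p. pure_tensor K H M a (act M b (coinv_proj p))) (coact M n)) (coact M n)"
  proof (rule tensor_lift_cong[OF H_module M_module _ _ HM_module coact_closed[OF n]])
    fix a n assume an: "a \<in> carrier H" "n \<in> carrier M"
    have "pure_tensor K H M a n =
      pure_tensor K H M a (tensor_lift K H M M (\<lambda>b p. act M b (coinv_proj p)) (coact M n))"
      by (simp add: act_coinv_proj an)
    also have "\<dots> = tensor_lift K H M HM (\<lambda>b p. pure_tensor K H M a (act M b (coinv_proj p))) (coact M n)"
      by (rule linear_map_lift[OF bilinear_mapsD(1)[OF pure_tensor_bilinear[OF H_module M_module] an(1)] _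
            coact_closed[OF an(2)] H_module M_module M_module HM_module])
        (fast intro: linear_intros)
    finally show "pure_tensor K H M a n =
      tensor_lift K H M HM (\<lambda>b p. pure_tensor K H M a (act M b (coinv_proj p))) (coact M n)" .
    then show "tensor_lift K H M HM (\<lambda>b p. pure_tensor K H M a (act M b (coinv_proj p))) (coact M n) \<in> carrier HM"
      using pure_tensor_closed[OF H_module M_module an] by simp
  qed
  also have "\<dots> = tensor_lift K H M HM
      (\<lambda>a p. tensor_lift K H H HM (\<lambda>c d. pure_tensor K H M c (act M d (coinv_proj p))) (comult H a)) (coact M n)"
    by (rule coact_coassoc[OF M_left_comodule HM_module n, symmetric]) (fast intro: linear_intros)+
  \<comment> \<open>Reading c as c 1 exhibits c (x) d E(p) as the diagonal action on 1 (x)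
    E(p).\<close>
  also have "\<dots> = tensor_lift K H M HM
      (\<lambda>b p. diag_act (comult H b) (pure_tensor K H M \<one>\<^bsub>H\<^esub> (coinv_proj p))) (coact M n)"
  proof (rule tensor_lift_cong[OF H_module M_module _ _ HM_module coact_closed[OF n]])
    fix a p assume ap: "a \<in> carrier H" "p \<in> carrier M"
    have \<Delta>: "comult H a \<in> carrier (tensor K H H)" by (rule linear_mapsD(1)[OF comult_linear ap(1)])
    show "tensor_lift K H H HM (\<lambda>c d. pure_tensor K H M c (act M d (coinv_proj p))) (comult H a) =
      diag_act (comult H a) (pure_tensor K H M \<one>\<^bsub>H\<^esub> (coinv_proj p))"
      unfolding diag_act_pure_right[OF \<Delta> H.one_closed coinv_proj_closed[OF ap(2)]]
      by (rule tensor_lift_cong[OF H_module H_module _ _ HM_module \<Delta>])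
        (simp, use ap in \<open>fast intro: linear_intros\<close>)
    show "diag_act (comult H a) (pure_tensor K H M \<one>\<^bsub>H\<^esub> (coinv_proj p)) \<in> carrier HM"
      using ap by (fast intro: linear_intros)
  qed
  finally show "tensor_lift K H M diag_module (\<lambda>b p. act diag_module b (coact M (coinv_proj p))) (coact M n) =
    tensor_lift K H M diag_module
      (\<lambda>b p. act diag_module b (pure_tensor K H M \<one>\<^bsub>H\<^esub> (coinv_proj p))) (coact M n)"
    by simp
qed

end

section \<open>The mutually inverse maps between M and H (x) V\<close>

context hopf_module_over
begin

lemma coinvariantsD:
  assumes "v \<in> coinvariants K H M"
  shows "v \<in> carrier M" and "coact M v = pure_tensor K H M \<one>\<^bsub>H\<^esub> v"
  using assms by (simp_all add: coinvariants_def)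

lemma V_sel [simp]:
  "carrier V = coinvariants K H M" "add V = add M" "zero V = zero M" "smult V = smult M"
  by (simp_all add: coinvariant_space_def)

text \<open>The coinvariants are the equalizer of the coaction and the linear map m to 1 (x)
  m.\<close>

lemma V_module [linear_intros]: "module K V"
proof -
  have "submodule (coinvariants K H M) K M"
    unfolding coinvariants_def
    by (rule linear_maps_equalizer[OF coact_linear _ M_module HM_module]) (fast intro: linear_intros)
  then have "module K (M\<lparr>carrier := coinvariants K H M\<rparr>)"
    by (rule submodule.submodule_is_module[OF _ M_module])
  then show ?thesis
    by (rule iffD1[OF module_cong, rotated -1]) simp_all
qed

text \<open>\<open>tensor K H V\<close> and \<open>tensor K H M\<close> are in general quotients of
  different free modules, and the former is not treated as a subspace of the latter. Maps are
  therefore retyped with V as source or target before entering tensor constructions.\<close>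

lemma V_restrict:
  assumes f: "f \<in> linear_maps K M W"
  shows "f \<in> linear_maps K V W"
  by (rule linear_mapsI) (simp_all add: linear_mapsD[OF f] coinvariantsD(1))

lemma coinv_proj_linear_V: "coinv_proj \<in> linear_maps K M V"
  by (rule linear_mapsI)
    (simp_all add: coinv_proj_closed coinv_proj_coinvariant coinvariants_def
      linear_mapsD(2,3)[OF coinv_proj_linear])

lemma act_bilinear_V: "act M \<in> bilinear_maps K H V M"
  using act_bilinear by (auto simp: bilinear_maps_def coinvariantsD(1) intro: V_restrict)

text \<open>Since coact(v) = 1 (x) v, Hopf compatibility leaves h_1 1 (x) h_2 v.\<close>

lemma coact_act_coinvariant:
  assumes h: "h \<in> carrier H" and v: "v \<in> coinvariants K H M"
  shows "coact M (act M h v) = tensor_lift K H H HM (\<lambda>a b. pure_tensor K H M a (act M b v)) (comult H h)"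
proof -
  have \<Delta>: "comult H h \<in> carrier (tensor K H H)" by (rule linear_mapsD(1)[OF comult_linear h])
  have "coact M (act M h v) = tensor_lift K H H HM
      (\<lambda>a b. pure_tensor K H M (a \<otimes>\<^bsub>H\<^esub> \<one>\<^bsub>H\<^esub>) (act M b v)) (comult H h)"
    using diag_act_pure_right[OF \<Delta> H.one_closed coinvariantsD(1)[OF v]]
    by (simp add: coact_act h coinvariantsD[OF v] diag_act_def)
  also have "\<dots> = tensor_lift K H H HM (\<lambda>a b. pure_tensor K H M a (act M b v)) (comult H h)"
    by (rule tensor_lift_cong[OF H_module H_module _ _ HM_module \<Delta>])
      (simp, use coinvariantsD(1)[OF v] in \<open>fast intro: linear_intros\<close>)
  finally show ?thesis .
qed

text \<open>By \<open>coact_act_coinvariant\<close> the left side is S(h_1) h_2 v, which the left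
  antipode axiom collapses. This is the value needed to invert h (x) v to h v.\<close>

lemma coinv_proj_act:
  assumes h: "h \<in> carrier H" and v: "v \<in> coinvariants K H M"
  shows "coinv_proj (act M h v) = counit H h \<odot>\<^bsub>M\<^esub> v"
proof -
  note vM = coinvariantsD(1)[OF v]
  have \<Delta>: "comult H h \<in> carrier (tensor K H H)" by (rule linear_mapsD(1)[OF comult_linear h])
  have B: "(\<lambda>a n. act M (antipode H a) n) \<in> bilinear_maps K H M M" by (fast intro: linear_intros)
  have B2: "(\<lambda>a b. pure_tensor K H M a (act M b v)) \<in> bilinear_maps K H H HM"
    using vM by (fast intro: linear_intros)
  note av = bilinear_mapsD(2)[OF act_bilinear vM]
  have "coinv_proj (act M h v) = tensor_lift K H H M (\<lambda>a b.
      tensor_lift K H M M (\<lambda>a n. act M (antipode H a) n) (pure_tensor K H M a (act M b v))) (comult H h)"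
    unfolding coinv_proj_def coact_act_coinvariant[OF assms]
    by (rule linear_map_lift[OF tensor_lift_linear[OF H_module M_module M_module B] B2 \<Delta>
          H_module H_module HM_module M_module])
  also have "\<dots> = tensor_lift K H H M (\<lambda>a b. act M (antipode H a \<otimes>\<^bsub>H\<^esub> b) v) (comult H h)"
    by (rule tensor_lift_cong[OF H_module H_module _ _ M_module \<Delta>])
      (simp_all add: tensor_lift_pure[OF H_module M_module M_module B] act_mult vM
        bilinear_mapsD(3)[OF act_bilinear] linear_mapsD(1)[OF antipode_linear])
  also have "\<dots> = act M (tensor_lift K H H H (\<lambda>a b. antipode H a \<otimes>\<^bsub>H\<^esub> b) (comult H h)) v"
    by (rule linear_map_lift[OF av _ \<Delta> H_module H_module H_module M_module, symmetric])
      (fast intro: linear_intros)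
  also have "\<dots> = counit H h \<odot>\<^bsub>M\<^esub> v"
    by (simp add: antipode_left h linear_mapsD(3)[OF av] counit_closed act_one vM)
  finally show ?thesis .
qed

definition coinv_decomp :: "'m \<Rightarrow> ('k, 'h, 'm) tensor"
  where "coinv_decomp m = tensor_map K H M H V (\<lambda>h. h) coinv_proj (coact M m)"

abbreviation "HV \<equiv> tensor K H V"
abbreviation "coinv_comp \<equiv> tensor_lift K H V M (act M)"

lemma HV_module: "module K HV" by (rule tensor_module[OF H_module V_module])

lemma coinv_decomp_linear: "coinv_decomp \<in> linear_maps K M HV"
proof -
  have "(\<lambda>m. coinv_decomp m) \<in> linear_maps K M HV"
    unfolding coinv_decomp_def
    by (rule linear_maps_comp[OF tensor_map_linear[OF H_module M_module H_module V_module
            linear_maps_id coinv_proj_linear_V] coact_linear])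
  then show ?thesis .
qed

lemma coinv_comp_linear: "coinv_comp \<in> linear_maps K HV M"
  by (rule tensor_lift_linear[OF H_module V_module M_module act_bilinear_V])

text \<open>By substitution the composite is m_(-1) E(m_(0)).\<close>

lemma coinv_comp_decomp:
  assumes m: "m \<in> carrier M"
  shows "coinv_comp (coinv_decomp m) = m"
  unfolding coinv_decomp_def
    tensor_lift_map[OF H_module M_module H_module V_module linear_maps_id coinv_proj_linear_V
      M_module act_bilinear_V coact_closed[OF m]]
  by (rule act_coinv_proj[OF m])

text \<open>On h (x) v the composite is h_1 (x) E(h_2 v) = h_1 (x) counit(h_2) v, and the right
  counit axiom of H finishes.\<close>

lemma coinv_decomp_comp:
  assumes x: "x \<in> carrier HV"
  shows "coinv_decomp (coinv_comp x) = x"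
proof (rule tensor_ext[OF H_module V_module HV_module
      linear_maps_comp[OF coinv_decomp_linear coinv_comp_linear] linear_maps_id _ x])
  fix h v assume h: "h \<in> carrier H" and v: "v \<in> carrier V"
  then have vM: "v \<in> carrier M" and vV: "v \<in> coinvariants K H M" by (simp_all add: coinvariantsD(1))
  have \<Delta>: "comult H h \<in> carrier (tensor K H H)" by (rule linear_mapsD(1)[OF comult_linear h])
  have B: "(\<lambda>a b. pure_tensor K H M a (act M b v)) \<in> bilinear_maps K H H HM"
    using vM by (fast intro: linear_intros)
  note P = bilinear_mapsD[OF pure_tensor_bilinear[OF H_module V_module]]
  note L = tensor_map_linear[OF H_module M_module H_module V_module linear_maps_id coinv_proj_linear_V]
  have "coinv_decomp (coinv_comp (pure_tensor K H V h v)) =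
    tensor_map K H M H V (\<lambda>h. h) coinv_proj (tensor_lift K H H HM (\<lambda>a b. pure_tensor K H M a (act M b v)) (comult H h))"
    by (simp add: tensor_lift_pure[OF H_module V_module M_module act_bilinear_V h v]
        coinv_decomp_def coact_act_coinvariant[OF h vV])
  also have "\<dots> = tensor_lift K H H HV (\<lambda>a b. tensor_map K H M H V (\<lambda>h. h) coinv_proj
      (pure_tensor K H M a (act M b v))) (comult H h)"
    by (rule linear_map_lift[OF L B \<Delta> H_module H_module HM_module HV_module])
  also have "\<dots> = tensor_lift K H H HV (\<lambda>a b. pure_tensor K H V (counit H b \<odot>\<^bsub>H\<^esub> a) v) (comult H h)"
  proof (rule tensor_lift_cong[OF H_module H_module _ _ HV_module \<Delta>])
    fix a b assume ab: "a \<in> carrier H" "b \<in> carrier H"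
    have "tensor_map K H M H V (\<lambda>h. h) coinv_proj (pure_tensor K H M a (act M b v)) =
      pure_tensor K H V a (counit H b \<odot>\<^bsub>V\<^esub> v)"
      using ab vM by (simp add: tensor_map_pure[OF H_module M_module H_module V_module linear_maps_id
            coinv_proj_linear_V] bilinear_mapsD(3)[OF act_bilinear] coinv_proj_act vV)
    \<comment> \<open>The scalar crosses the tensor sign, from v to a, so that the sum can be
      evaluated inside H.\<close>
    also have "\<dots> = counit H b \<odot>\<^bsub>HV\<^esub> pure_tensor K H V a v"
      by (rule linear_mapsD(3)[OF P(1)[OF ab(1)] counit_closed[OF ab(2)] v])
    also have "\<dots> = pure_tensor K H V (counit H b \<odot>\<^bsub>H\<^esub> a) v"
      by (rule linear_mapsD(3)[OF P(2)[OF v] counit_closed[OF ab(2)] ab(1), symmetric])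
    finally show "tensor_map K H M H V (\<lambda>h. h) coinv_proj (pure_tensor K H M a (act M b v)) =
      pure_tensor K H V (counit H b \<odot>\<^bsub>H\<^esub> a) v" .
  qed (use v in \<open>fast intro: linear_intros\<close>)
  also have "\<dots> = pure_tensor K H V (tensor_lift K H H H (\<lambda>a b. counit H b \<odot>\<^bsub>H\<^esub> a) (comult H h)) v"
    by (rule linear_map_lift[OF P(2)[OF v] _ \<Delta> H_module H_module H_module HV_module, symmetric])
      (fast intro: linear_intros)
  finally show "coinv_decomp (coinv_comp (pure_tensor K H V h v)) = pure_tensor K H V h v"
    by (simp add: counit_right h)
qed

lemma coinv_decomp_bij: "bij_betw coinv_decomp (carrier M) (carrier HV)"
  by (rule bij_betw_byWitness[where f' = coinv_comp])
    (auto simp: coinv_comp_decomp coinv_decomp_comp linear_mapsD(1)[OF coinv_decomp_linear]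
      linear_mapsD(1)[OF coinv_comp_linear])

text \<open>H-linearity is shown for the inverse map, where it is only associativity of the action
  on h g (x) v. A direct proof for \<open>coinv_decomp\<close> would have to expand E(h m) for m
  that is not coinvariant.\<close>

lemma coinv_comp_act:
  assumes h: "h \<in> carrier H" and x: "x \<in> carrier HV"
  shows "coinv_comp (act (free_hopf_module K H V) h x) = act M h (coinv_comp x)"
proof (rule tensor_ext[OF H_module V_module M_module
      linear_maps_comp[OF coinv_comp_linear bilinear_mapsD(1)[OF free_act_bilinear[OF V_module] h]]
      linear_maps_comp[OF bilinear_mapsD(1)[OF act_bilinear h] coinv_comp_linear] _ x])
  fix g v assume "g \<in> carrier H" "v \<in> carrier V"
  then show "coinv_comp (act (free_hopf_module K H V) h (pure_tensor K H V g v)) =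
    act M h (coinv_comp (pure_tensor K H V g v))"
    using h coinvariantsD(1)[of v]
    by (simp add: free_act_pure[OF V_module] tensor_lift_pure[OF H_module V_module M_module act_bilinear_V]
        act_mult)
qed

text \<open>H-linearity is inherited from the inverse. Colinearity is direct: coassociativity of M
  turns m_(-1)1 (x) (m_(-1)2 (x) E(m_(0))) into m_(-1) (x) \<open>coinv_decomp\<close>
  m_(0).\<close>

lemma coinv_decomp_hopf: "coinv_decomp \<in> hopf_module_maps K H M (free_hopf_module K H V)"
proof -
  let ?fr = "free_hopf_module K H V" and ?U = "tensor K H HV"
  note U = tensor_module[OF H_module HV_module]
  have "coinv_decomp (act M h m) = act ?fr h (coinv_decomp m)"
    if h: "h \<in> carrier H" and m: "m \<in> carrier M" for h m
  proof -
    have dm: "coinv_decomp m \<in> carrier HV" by (rule linear_mapsD(1)[OF coinv_decomp_linear m])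
    have "coinv_decomp (act M h m) = coinv_decomp (coinv_comp (act ?fr h (coinv_decomp m)))"
      by (simp add: coinv_comp_act[OF h dm] coinv_comp_decomp[OF m])
    also have "\<dots> = act ?fr h (coinv_decomp m)"
      by (rule coinv_decomp_comp[OF bilinear_mapsD(3)[OF free_act_bilinear[OF V_module] h dm]])
    finally show ?thesis .
  qed
  moreover have "coact ?fr (coinv_decomp m) = tensor_map K H M H HV (\<lambda>x. x) coinv_decomp (coact M m)"
    if m: "m \<in> carrier M" for m
  proof -
    note \<rho>m = coact_closed[OF m]
    note rules = linear_intros HV_module linear_maps_comp[OF coinv_proj_linear_V]
      linear_mapsD(1)[OF coinv_proj_linear_V]
    have B: "(\<lambda>a n. pure_tensor K H V a (coinv_proj n)) \<in> bilinear_maps K H M HV"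
      by (fast intro: rules)
    have dec: "coinv_decomp n = tensor_lift K H M HV (\<lambda>a n. pure_tensor K H V a (coinv_proj n)) (coact M n)" for n
      by (simp add: coinv_decomp_def tensor_map_def)
    have "coact ?fr (coinv_decomp m) =
      tensor_lift K H M ?U (\<lambda>a n. coact ?fr (pure_tensor K H V a (coinv_proj n))) (coact M m)"
      unfolding dec by (rule linear_map_lift[OF free_coact_linear[OF V_module] B \<rho>m
            H_module M_module HV_module U])
    also have "\<dots> = tensor_lift K H M ?U (\<lambda>a n. tensor_lift K H H ?U
        (\<lambda>b c. pure_tensor K H HV b (pure_tensor K H V c (coinv_proj n))) (comult H a)) (coact M m)"
      by (rule tensor_lift_cong[OF H_module M_module _ _ U \<rho>m],
          rule free_coact_pure[OF V_module _ linear_mapsD(1)[OF coinv_proj_linear_V]])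
        (assumption | fast intro: rules)+
    \<comment> \<open>Coassociativity moves the splitting from a to n; the inner sum becomes
      \<open>coinv_decomp\<close> n up to tensoring with a.\<close>
    also have "\<dots> = tensor_lift K H M ?U (\<lambda>a n. tensor_lift K H M ?U
        (\<lambda>b p. pure_tensor K H HV a (pure_tensor K H V b (coinv_proj p))) (coact M n)) (coact M m)"
      by (rule coact_coassoc[OF M_left_comodule U m]) (fast intro: rules)+
    also have "\<dots> = tensor_lift K H M ?U (\<lambda>a n. pure_tensor K H HV a (coinv_decomp n)) (coact M m)"
    proof (rule tensor_lift_cong[OF H_module M_module _ _ U \<rho>m])
      fix a n assume an: "a \<in> carrier H" "n \<in> carrier M"
      show "tensor_lift K H M ?U (\<lambda>b p. pure_tensor K H HV a (pure_tensor K H V b (coinv_proj p))) (coact M n) =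
        pure_tensor K H HV a (coinv_decomp n)"
        unfolding dec
        by (rule linear_map_lift[OF bilinear_mapsD(1)[OF pure_tensor_bilinear[OF H_module HV_module] an(1)] B
              coact_closed[OF an(2)] H_module M_module HV_module U, symmetric])
      show "pure_tensor K H HV a (coinv_decomp n) \<in> carrier ?U"
        by (rule pure_tensor_closed[OF H_module HV_module an(1) linear_mapsD(1)[OF coinv_decomp_linear an(2)]])
    qed
    finally show ?thesis by (simp add: tensor_map_def)
  qed
  ultimately show ?thesis
    using coinv_decomp_linear by (simp add: hopf_module_maps_def free_hopf_module_def)
qed

section \<open>Compatibility of the decomposition with Hopf module endomorphisms\<close>

lemma hopf_map_linear_V:
  assumes T: "T \<in> hopf_module_maps K H M M"
  shows "T \<in> linear_maps K V V"
proof -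
  note Tl = hopf_module_mapsD(1)[OF T]
  \<comment> \<open>Colinearity: coact(T v) = (id (x) T)(1 (x) v) = 1 (x) T v.\<close>
  have "T v \<in> coinvariants K H M" if v: "v \<in> coinvariants K H M" for v
    using hopf_module_mapsD(3)[OF T] coinvariantsD[OF v]
    by (simp add: coinvariants_def linear_mapsD(1)[OF Tl]
        tensor_map_pure[OF H_module M_module H_module M_module linear_maps_id Tl])
  then show ?thesis
    by (intro linear_mapsI) (simp_all add: coinvariantsD(1) linear_mapsD(2,3)[OF Tl])
qed

text \<open>E is built from the action and the coaction: colinearity brings T under the sum onto
  m_(0), and H-linearity carries it past S(m_(-1)).\<close>

lemma coinv_proj_hopf_map:
  assumes T: "T \<in> hopf_module_maps K H M M" and m: "m \<in> carrier M"
  shows "coinv_proj (T m) = T (coinv_proj m)"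
proof -
  note Tl = hopf_module_mapsD(1)[OF T]
  have B: "(\<lambda>a n. act M (antipode H a) n) \<in> bilinear_maps K H M M" by (fast intro: linear_intros)
  have "coinv_proj (T m) = tensor_lift K H M M (\<lambda>a n. act M (antipode H a) (T n)) (coact M m)"
    unfolding coinv_proj_def hopf_module_mapsD(3)[OF T m]
    by (rule tensor_lift_map[OF H_module M_module H_module M_module linear_maps_id Tl M_module B coact_closed[OF m]])
  also have "\<dots> = tensor_lift K H M M (\<lambda>a n. T (act M (antipode H a) n)) (coact M m)"
    by (rule tensor_lift_cong[OF H_module M_module _ _ M_module coact_closed[OF m]])
      (simp_all add: hopf_module_mapsD(2)[OF T] linear_mapsD(1)[OF antipode_linear]
        linear_mapsD(1)[OF Tl] bilinear_mapsD(3)[OF act_bilinear])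
  also have "\<dots> = T (coinv_proj m)"
    unfolding coinv_proj_def
    by (rule linear_map_lift[OF Tl B coact_closed[OF m] H_module M_module M_module M_module, symmetric])
  finally show ?thesis .
qed

text \<open>Both sides are maps of the form id (x) something applied to coact(m), with E T on the
  left and T E on the right.\<close>

lemma coinv_decomp_hopf_map:
  assumes T: "T \<in> hopf_module_maps K H M M" and m: "m \<in> carrier M"
  shows "coinv_decomp (T m) = tensor_map K H V H V (\<lambda>h. h) T (coinv_decomp m)"
proof -
  note Tl = hopf_module_mapsD(1)[OF T] and TV = hopf_map_linear_V[OF T]
  note TE = linear_maps_comp[OF TV coinv_proj_linear_V]
  have "coinv_decomp (T m) = tensor_map K H M H V (\<lambda>h. h) (\<lambda>n. coinv_proj (T n)) (coact M m)"
    unfolding coinv_decomp_def hopf_module_mapsD(3)[OF T m]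
    by (rule tensor_map_tensor_map[OF H_module M_module H_module M_module H_module V_module
          linear_maps_id Tl linear_maps_id coinv_proj_linear_V coact_closed[OF m]])
  also have "\<dots> = tensor_map K H M H V (\<lambda>h. h) (\<lambda>n. T (coinv_proj n)) (coact M m)"
    unfolding tensor_map_def
    by (rule tensor_lift_cong[OF H_module M_module _ _ HV_module coact_closed[OF m]],
        simp only: coinv_proj_hopf_map[OF T],
        rule pure_tensor_closed[OF H_module V_module _ linear_mapsD(1)[OF TE]])
  also have "\<dots> = tensor_map K H V H V (\<lambda>h. h) T (coinv_decomp m)"
    unfolding coinv_decomp_def
    by (rule tensor_map_tensor_map[OF H_module M_module H_module V_module H_module V_module
          linear_maps_id coinv_proj_linear_V linear_maps_id TV coact_closed[OF m], symmetric])
  finally show ?thesis .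
qed

end

theorem theorem6p5:
  fixes K :: "('k, 'r) ring_scheme"
    and H :: "('k, 'h) hopf_alg"
    and M :: "('k, 'h, 'm) hopf_mod"
    and lam :: 'k and T :: "'m \<Rightarrow> 'm"
  assumes "field K"
    and "lam \<in> carrier K"
    and "hopf_algebra K H"
    and "hopf_module K H M"
    and "T \<in> hopf_module_maps K H M M"
    and "generic_rb_hopf_module K H lam M T"
  defines "V \<equiv> coinvariant_space K H M"
  shows "generic_rb_isomorphic K H lam M T
           (free_hopf_module K H V)
           (tensor_map K H V H V (\<lambda>h. h) T)"
proof -
  interpret hopf_module_over K H M by unfold_locales fact+
  let ?T' = "tensor_map K H V H V (\<lambda>h. h) T" and ?N = "free_hopf_module K H V"
  have V: "module K V" unfolding V_def by (rule V_module)
  have TV: "T \<in> linear_maps K V V" unfolding V_def by (rule hopf_map_linear_V) fact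
  have bij: "bij_betw coinv_decomp (carrier M) (carrier ?N)"
    using coinv_decomp_bij by (simp add: free_hopf_module_def V_def)
  have carr: "carrier ?N = (coinv_decomp ` carrier M)"
    using bij by (simp add: bij_betw_def)
  have hom: "coinv_decomp \<in> hopf_module_maps K H M ?N" unfolding V_def by (rule coinv_decomp_hopf)
  note f = hopf_module_mapsD(1)[OF hom]
  have comm: "coinv_decomp (T m) = ?T' (coinv_decomp m)" if "m \<in> carrier M" for m
    unfolding V_def by (rule coinv_decomp_hopf_map) fact+
  have Tc: "T m \<in> carrier M" if "m \<in> carrier M" for m
    using linear_mapsD(1)[OF hopf_module_mapsD(1)[OF assms(5)] that] .
  have N: "hopf_module K H ?N" by (rule free_hopf_module_hopf[OF V])
  have Nm: "module K ?N" using N by (simp add: hopf_module_def left_module_def)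
  have quad: "?T' (?T' x) \<oplus>\<^bsub>?N\<^esub> lam \<odot>\<^bsub>?N\<^esub> ?T' x = \<zero>\<^bsub>?N\<^esub>" if "x \<in> carrier ?N" for x
  proof -
    \<comment> \<open>Surjectivity of the decomposition lets the identity on the target be checked
      on images of elements of M.\<close>
    from that[unfolded carr] obtain m where m: "x = coinv_decomp m" "m \<in> carrier M"
      by (rule imageE)
    interpret M: module K M by (rule M_module)
    \<comment> \<open>Intertwining, read from right to left, replaces T' by T under
      \<open>coinv_decomp\<close>; linearity then collects the two terms into one image.\<close>
    have "?T' (?T' x) \<oplus>\<^bsub>?N\<^esub> lam \<odot>\<^bsub>?N\<^esub> ?T' x = coinv_decomp (T (T m) \<oplus>\<^bsub>M\<^esub> lam \<odot>\<^bsub>M\<^esub> T m)"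
      using m Tc assms(2) by (simp add: comm[symmetric] linear_mapsD(2,3)[OF f])
    also have "\<dots> = \<zero>\<^bsub>?N\<^esub>"
      by (simp add: generic_rb_hopf_moduleD[OF assms(6,2) m(2)] linear_maps_zero[OF f M_module Nm])
    finally show ?thesis .
  qed
  have gen: "generic_rb_hopf_module K H lam ?N ?T'"
    by (rule generic_rb_hopf_moduleI[OF N free_tensor_map_hopf[OF V TV] assms(2) quad])
  show ?thesis
    unfolding generic_rb_isomorphic_def
    by (intro conjI assms(6) gen bexI[OF _ hom] bij ballI comm)
qed

end
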